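(* Let $p$ be an odd prime. If $\sigma\in GL_2(\mathbb{F}_p)$ has no eigenvalue equal to $1$, and $\mathcal{P}$ is a partition expressible in the form $$\mathcal{P}=\bigl(le,\ nf,\ (\pi_1d'')^{[m_1d']},\ (\pi_2d'')^{[m_2d']},\dots,(\pi_ud'')^{[m_ud']}\bigr),$$ feasible for tiling by $\sigma$-orbits, then $$|\mathrm{Fix}_{\mathcal{P}}(\sigma)|=O(\sigma,\mathcal{P})\binom{l+\frac{p-1}{e}-1}{l}^{*}\binom{n+\frac{p-1}{f}-1}{n}^{*}\prod_{i=1}^{u}\binom{\pi_i+\frac{p-1}{d''}-1}{\pi_i}^{m_i},$$ where $$O(\sigma,\mathcal{P})=\frac{o(\sigma)!}{(o(\sigma)-u)!\;m_1!\,m_2!\cdots m_u!},$$ and $1<e<f$ are the orders of the eigenvalues, if any. If an eigenvalue does not exist, the corresponding factor, marked with an asterisk, is set equal to $1$.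
   Context: Zero-sum multisets. Let $V_2(\mathbb{F}_p)$ be the space of columns of length $2$ over the field $\mathbb{F}_p$ with $p$ elements. A zero-sum multiset is a multiset $M$ of $R\ge 3$ non-zero vectors of $V_2(\mathbb{F}_p)$ whose sum (with multiplicity) is $0$ and which spans $V_2(\mathbb{F}_p)$. For each of the $p+1$ one-dimensional subspaces $L$ of $V_2(\mathbb{F}_p)$, let $\mu_L\ge 0$ be the number of elements of $M$ (with multiplicity) lying in $L$; the partition type of $M$ is the partition of $R$ whose parts are the non-zero $\mu_L$. For a partition $\mathcal{P}$, $\mathcal{M}(\mathcal{P})$ is the collection of zero-sum multisets of partition type $\mathcal{P}$. $GL_2(\mathbb{F}_p)$ acts on multisets elementwise by left multiplication, and $\mathrm{Fix}_{\mathcal{P}}(\sigma)=\{M\in\mathcal{M}(\mathcal{P}) : \sigma M=M\}$. The notation $a^{[k]}$ means the part $a$ repeated $k$ times. Types of elements. Central elements are the non-zero scalar matrices. A non-central $\sigma$ is elliptic, parabolic or hyperbolic if it has, respectively, zero, one or two (one-dimensional) eigenspaces in $V_2(\mathbb{F}_p)$. Central and elliptic elements are treated as having no eigenspaces. The central indicator $d'$ of $\sigma$ is the smallest positive integer such that $\sigma^{d'}$ is central; if $d$ is the order of $\sigma$, the central quotient is $d''=d/d'$. The order of an eigenvalue is its multiplicative order in $\mathbb{F}_p^*$; $e$ and $f$ denote the orders of the eigenvalues of a hyperbolic element, and $e$ the order of the eigenvalue of a parabolic element. Define $o(\sigma)=\frac{p+1}{d'}$ if $\sigma$ is elliptic or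 central, $o(\sigma)=\frac{p-1}{d'}$ if $\sigma$ is hyperbolic, and $o(\sigma)=1$ if $\sigma$ is parabolic. Feasibility. In the expression for $\mathcal{P}$ in the claim, $l,n,u\ge 0$ and $\pi_i,m_i\ge 1$ are integers, and one or both of the first two parts ($le$, $nf$) may be $0$, or possibly equal to one or two of the other parts. A partition so expressible is feasible for tiling by $\sigma$-orbits if $\sigma$ has central indicator $d'$ and central quotient $d''$, $u\le o(\sigma)$, and the following conditions hold according to the type of $\sigma$. Central: $l=n=0$ and $u>1$. Elliptic: $l=n=0$ and $u>0$. Parabolic: $n=0$ and $u=m_1=1$. Hyperbolic: if $u=0$, then $l,n>0$. (For $\sigma$ having an eigenvalue equal to $1$, there is an additional condition $l\neq 1$ in the last two cases, which does not arise here.)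
   Formalization: u is read as m_1+m_2+... with distinct π_i (else false: p=3, σ=-I, P=(2,4,4)); the formula is claimed if P has only one feasible expression, and in general |Fix_P(σ)| is the sum of the right-hand sides over all feasible expressions (p=5, e=2, f=4, P=(4,8) has two). *)

theory Defs
  imports "HOL-Analysis.Analysis" "HOL-Computational_Algebra.Primes"
begin

text \<open>
  The field with $p$ elements is any type \<open>'a\<close> of class \<open>field\<close> and \<open>finite\<close> such that
  \<^term>\<open>CARD('a)\<close> is the prime $p$.
\<close>

section \<open>Zero-sum multisets\<close>

definition lines :: "('a::{field,finite} ^ 2) set set" where
  "lines = {L. vec.subspace L \<and> vec.dim L = 1}"

definition zero_sum_multiset :: "('a::{field,finite} ^ 2) multiset \<Rightarrow> bool" where
  "zero_sum_multiset M \<longleftrightarrow>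
     size M \<ge> 3 \<and> 0 \<notin># M \<and> \<Sum>\<^sub># M = 0 \<and> vec.span (set_mset M) = UNIV"

definition mu :: "('a::{field,finite} ^ 2) multiset \<Rightarrow> ('a ^ 2) set \<Rightarrow> nat" where
  "mu M L = size (filter_mset (\<lambda>v. v \<in> L) M)"

definition partition_type :: "('a::{field,finite} ^ 2) multiset \<Rightarrow> nat multiset" where
  "partition_type M = filter_mset (\<lambda>k. k > 0) (image_mset (mu M) (mset_set lines))"

definition multisets_of_type :: "nat multiset \<Rightarrow> ('a::{field,finite} ^ 2) multiset set" where
  "multisets_of_type P = {M. zero_sum_multiset M \<and> partition_type M = P}"

definition Fix :: "nat multiset \<Rightarrow> ('a::{field,finite}) ^ 2 ^ 2 \<Rightarrow> ('a ^ 2) multiset set" where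
  "Fix P \<sigma> = {M \<in> multisets_of_type P. image_mset (\<lambda>v. \<sigma> *v v) M = M}"


section \<open>Types of elements\<close>

definition matrix_power :: "('a::field) ^ 2 ^ 2 \<Rightarrow> nat \<Rightarrow> 'a ^ 2 ^ 2" where
  "matrix_power A k = ((\<lambda>B. A ** B) ^^ k) (mat 1)"

definition central :: "('a::field) ^ 2 ^ 2 \<Rightarrow> bool" where
  "central A \<longleftrightarrow> (\<exists>c. c \<noteq> 0 \<and> A = mat c)"

definition eigenspace :: "('a::field) ^ 2 ^ 2 \<Rightarrow> 'a \<Rightarrow> ('a ^ 2) set" where
  "eigenspace A c = {v. A *v v = c *s v}"

definition eigenvalue :: "('a::field) ^ 2 ^ 2 \<Rightarrow> 'a \<Rightarrow> bool" where
  "eigenvalue A c \<longleftrightarrow> (\<exists>v. v \<noteq> 0 \<and> A *v v = c *s v)"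

definition eigenlines :: "('a::field) ^ 2 ^ 2 \<Rightarrow> ('a ^ 2) set set" where
  "eigenlines A = {E. (\<exists>c. E = eigenspace A c) \<and> vec.dim E = 1}"

definition elliptic :: "('a::{field,finite}) ^ 2 ^ 2 \<Rightarrow> bool" where
  "elliptic A \<longleftrightarrow> \<not> central A \<and> card (eigenlines A) = 0"

definition parabolic :: "('a::{field,finite}) ^ 2 ^ 2 \<Rightarrow> bool" where
  "parabolic A \<longleftrightarrow> \<not> central A \<and> card (eigenlines A) = 1"

definition hyperbolic :: "('a::{field,finite}) ^ 2 ^ 2 \<Rightarrow> bool" where
  "hyperbolic A \<longleftrightarrow> \<not> central A \<and> card (eigenlines A) = 2"

definition matrix_order :: "('a::{field,finite}) ^ 2 ^ 2 \<Rightarrow> nat" where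
  "matrix_order A = (LEAST k. k > 0 \<and> matrix_power A k = mat 1)"

definition central_indicator :: "('a::{field,finite}) ^ 2 ^ 2 \<Rightarrow> nat" where
  "central_indicator A = (LEAST k. k > 0 \<and> central (matrix_power A k))"

text \<open>
  For invertible matrices the natural-number quotients below are exact: the central
  indicator divides the order, and (depending on the type) also $p+1$ or $p-1$.
\<close>

definition central_quotient :: "('a::{field,finite}) ^ 2 ^ 2 \<Rightarrow> nat" where
  "central_quotient A = matrix_order A div central_indicator A"

definition orbit_number :: "('a::{field,finite}) ^ 2 ^ 2 \<Rightarrow> nat" where
  "orbit_number A =
     (if elliptic A \<or> central A then (CARD('a) + 1) div central_indicator A
      else if hyperbolic A then (CARD('a) - 1) div central_indicator A
      else 1)"

definition mult_order :: "'a::{field,finite} \<Rightarrow> nat" where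
  "mult_order c = (LEAST k. k > 0 \<and> c ^ k = 1)"

text \<open>
  Central and elliptic elements are treated as having no eigenvalues; for them \<open>e\<close> and \<open>f\<close>
  are unconstrained and do not influence anything below.  A parabolic element has no
  second eigenvalue, so that \<open>f\<close> is irrelevant.
\<close>

definition eigenvalue_orders :: "('a::{field,finite}) ^ 2 ^ 2 \<Rightarrow> nat \<Rightarrow> nat \<Rightarrow> bool" where
  "eigenvalue_orders A e f \<longleftrightarrow>
     (parabolic A \<longrightarrow> 1 < e \<and> (\<exists>a. eigenvalue A a \<and> mult_order a = e)) \<and>
     (hyperbolic A \<longrightarrow> 1 < e \<and> e < f \<and>
        (\<exists>a b. a \<noteq> b \<and> eigenvalue A a \<and> eigenvalue A b \<and> mult_order a = e \<and> mult_order b = f))"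


section \<open>Expressions feasible for tiling\<close>

text \<open>
  The data $(\pi_1,m_1), (\pi_2,m_2), \dots$ with pairwise distinct $\pi_i$ are encoded as the
  multiset \<open>Q\<close> that contains each $\pi_i$ with multiplicity $m_i$; its size $\sum_i m_i$ is the
  number $u$ of non-trivial orbits of lines that are tiled, and
  $(\pi_i d'')^{[m_i d']}$ contributes $m_i d'$ copies of $\pi_i d''$.
  A triple \<open>(l, n, Q)\<close> determines the partition, but a partition can have several feasible
  expressions: $(l e, n f)$ can coincide with $(n' f, l' e)$ up to order, and for $d' = 2$ the
  eigenspace parts can also be exchanged with a pair of equal remaining parts.
\<close>

definition expressed_partition ::
  "('a::{field,finite}) ^ 2 ^ 2 \<Rightarrow> nat \<Rightarrow> nat \<Rightarrow> nat \<times> nat \<times> nat multiset \<Rightarrow> nat multiset" where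
  "expressed_partition \<sigma> e f = (\<lambda>(l, n, Q).
     filter_mset (\<lambda>k. k > 0) {# l * e, n * f #} +
     repeat_mset (central_indicator \<sigma>) (image_mset (\<lambda>q. q * central_quotient \<sigma>) Q))"

definition feasible ::
  "('a::{field,finite}) ^ 2 ^ 2 \<Rightarrow> nat \<times> nat \<times> nat multiset \<Rightarrow> bool" where
  "feasible \<sigma> = (\<lambda>(l, n, Q).
     (\<forall>q \<in># Q. q \<ge> 1) \<and>
     size Q \<le> orbit_number \<sigma> \<and>
     (central \<sigma> \<longrightarrow> l = 0 \<and> n = 0 \<and> size Q > 1) \<and>
     (elliptic \<sigma> \<longrightarrow> l = 0 \<and> n = 0 \<and> size Q > 0) \<and>
     (parabolic \<sigma> \<longrightarrow> n = 0 \<and> size Q = 1) \<and>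
     (hyperbolic \<sigma> \<longrightarrow> size Q = 0 \<longrightarrow> l > 0 \<and> n > 0))"

definition feasible_expressions ::
  "('a::{field,finite}) ^ 2 ^ 2 \<Rightarrow> nat \<Rightarrow> nat \<Rightarrow> nat multiset \<Rightarrow> (nat \<times> nat \<times> nat multiset) set" where
  "feasible_expressions \<sigma> e f P = {E. feasible \<sigma> E \<and> expressed_partition \<sigma> e f E = P}"

definition orbit_choices :: "('a::{field,finite}) ^ 2 ^ 2 \<Rightarrow> nat multiset \<Rightarrow> real" where
  "orbit_choices \<sigma> Q =
     fact (orbit_number \<sigma>) /
     (fact (orbit_number \<sigma> - size Q) * (\<Prod>q \<in> set_mset Q. fact (count Q q)))"

definition tiling_count ::
  "('a::{field,finite}) ^ 2 ^ 2 \<Rightarrow> nat \<Rightarrow> nat \<Rightarrow> nat \<times> nat \<times> nat multiset \<Rightarrow> real" where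
  "tiling_count \<sigma> e f = (\<lambda>(l, n, Q).
     orbit_choices \<sigma> Q *
     (if parabolic \<sigma> \<or> hyperbolic \<sigma>
      then real ((l + (CARD('a) - 1) div e - 1) choose l) else 1) *
     (if hyperbolic \<sigma>
      then real ((n + (CARD('a) - 1) div f - 1) choose n) else 1) *
     (\<Prod>q \<in> set_mset Q.
        real ((q + (CARD('a) - 1) div central_quotient \<sigma> - 1) choose q) ^ count Q q))"

end

theory Submission
  imports Defs "HOL-Combinatorics.Orbits" "HOL-Combinatorics.Multiset_Permutations"
begin

text \<open>
  As \<open>1\<close> is not an eigenvalue, the sum of an invariant multiset vanishes, being a fixed vector; the
  multiset then spans as soon as it meets two lines, and its size is then at least \<open>3\<close>. So only
  the partition type of invariant multisets has to be controlled.

  If \<open>v\<close> is not an eigenvector and \<open>A^j v\<close> is a multiple of \<open>v\<close>, then \<open>A^j\<close> is central, because it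
  acts as the same scalar on the basis \<open>v\<close>, \<open>A v\<close>. Hence the lines that are not eigenlines fall into
  \<open>A\<close>-orbits of size \<open>d'\<close>, and their non-zero vectors into \<open>A\<close>-orbits of size \<open>d = d' d''\<close>. An
  invariant multiset is a free choice of a multiset of vector orbits inside each orbit of lines;
  choosing \<open>q\<close> of the \<open>(p - 1) / d''\<close> vector orbits gives the part \<open>q d''\<close> repeated \<open>d'\<close> times.
  On the eigenlines the vector orbits have size \<open>e\<close> and \<open>f\<close> instead. Counting the labellings of the
  \<open>o(A)\<close> orbits of lines with prescribed multiset of labels gives the multinomial factor.
\<close>

section \<open>Invariant multisets of a permutation\<close>

text \<open>A partition need not reveal which of its parts sit on eigenlines, so a direct count by
  partition type would mix several situations. The count is organised instead by
  \<open>expression M\<close>, which separates the multiplicities on eigenlines from those on the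
  other blocks. An invariant multiset has exactly one expression, and \<open>Fix\<close> is the
  disjoint union of the fibres over the feasible expressions of the partition.

  Tiled and untiled blocks are treated alike by giving an untiled block the label 0. Padding
  \<open>Q\<close> with zeros to one label per block is the origin of (o - u)! in the denominator,
  while a label 0 contributes the binomial coefficient 1.

  For an expression read off from an invariant multiset, feasibility is equivalent to the presence
  of at least two parts, which is exactly the condition left over from spanning. The quotients (p -
  1)/d'', (p - 1)/e, (p - 1)/f are exact because each is obtained as a number of vector orbits in a
  block.\<close>

lemma count_image_mset_inj: "inj f \<Longrightarrow> count (image_mset f M) (f x) = count M x"
  by (induction M) (auto simp: inj_eq)

lemma image_mset_eq_iff_count:
  assumes "bij T"
  shows "image_mset T M = M \<longleftrightarrow> (\<forall>x. count M (T x) = count M x)"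
proof
  assume "image_mset T M = M"
  then show "\<forall>x. count M (T x) = count M x"
    by (metis assms bij_is_inj count_image_mset_inj)
next
  assume *: "\<forall>x. count M (T x) = count M x"
  show "image_mset T M = M"
  proof (rule multiset_eqI)
    fix y
    obtain x where "y = T x" using assms by (metis bij_pointE)
    then show "count (image_mset T M) y = count M y"
      using * assms by (simp add: bij_is_inj count_image_mset_inj)
  qed
qed

definition invariant_multisets :: "('b \<Rightarrow> 'b) \<Rightarrow> 'b set \<Rightarrow> 'b multiset set" where
  "invariant_multisets T S = {M. set_mset M \<subseteq> S \<and> image_mset T M = M}"

lemma orbit_eq_iff_mem:
  assumes "permutation T"
  shows "orbit T x = orbit T y \<longleftrightarrow> x \<in> orbit T y"
proof
  assume "orbit T x = orbit T y"
  then show "x \<in> orbit T y" using permutation_self_in_orbit[OF assms, of x] by simp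
next
  assume x: "x \<in> orbit T y"
  have "cyclic_on T (orbit T y)" using cyclic_on_orbit'[OF assms] .
  from orbit_cyclic_eq3[OF this x] show "orbit T x = orbit T y" .
qed

lemma orbit_closed_subset:
  assumes "T ` S \<subseteq> S" "x \<in> S"
  shows "orbit T x \<subseteq> S"
proof
  fix y assume "y \<in> orbit T x"
  then show "y \<in> S" by induct (use assms in auto)
qed

lemma Union_orbits:
  assumes "permutation T" "T ` S \<subseteq> S"
  shows "\<Union> (orbit T ` S) = S"
  using permutation_self_in_orbit[OF assms(1)] orbit_closed_subset[OF assms(2)] by blast

lemma orbits_disjoint:
  assumes "permutation T" "b \<in> orbit T ` S" "c \<in> orbit T ` S" "b \<noteq> c"
  shows "b \<inter> c = {}"
  using assms by (metis (no_types, lifting) disjoint_iff image_iff orbit_eq_iff_mem)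

text \<open>Equal orbit sizes turn the partition into orbits into an exact division. Applied to the
  vectors of a block it shows that \<open>quot\<close> divides p - 1; applied to lines it gives the
  number of blocks in \<open>I0\<close>.\<close>

lemma card_eq_card_orbits_mult:
  assumes T: "permutation T" "T ` S \<subseteq> S" and "finite S"
    and s: "\<And>x. x \<in> S \<Longrightarrow> card (orbit T x) = s"
  shows "s * card (orbit T ` S) = card S"
proof -
  have "s * card (orbit T ` S) = card (\<Union> (orbit T ` S))"
    by (rule card_partition) (use assms orbits_disjoint[OF T(1)] Union_orbits[OF T] in auto)
  then show ?thesis by (simp add: Union_orbits[OF T])
qed

text \<open>By \<open>per\<close>, the return times of \<open>x\<close> are exactly the multiples of
  \<open>s\<close>. Two equal iterates below \<open>s\<close> would, after cancelling the earlier
  one by injectivity, give a positive return time smaller than \<open>s\<close>.\<close>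

lemma card_orbit_eq_period:
  assumes "inj f" "s > 0" and per: "\<And>j. (f ^^ j) x = x \<longleftrightarrow> s dvd j"
  shows "card (orbit f x) = s"
proof -
  have "orbit f x = (\<lambda>m. (f ^^ m) x) ` {..<s}"
    using orbit_altdef_bounded[of s f x] assms by auto
  moreover have "inj_on (\<lambda>m. (f ^^ m) x) {..<s}"
  proof (rule linorder_inj_onI)
    fix i j assume ij: "i < j" "i \<in> {..<s}" "j \<in> {..<s}"
    show "(f ^^ i) x \<noteq> (f ^^ j) x"
    proof
      assume eq: "(f ^^ i) x = (f ^^ j) x"
      have "(f ^^ j) x = (f ^^ i) ((f ^^ (j - i)) x)"
        using ij by (metis comp_apply funpow_add le_add_diff_inverse less_imp_le)
      with eq have "(f ^^ (j - i)) x = x"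
        using inj_fn[OF assms(1), of i] by (metis injD)
      then show False using per ij by (auto dest: dvd_imp_le)
    qed
  qed auto
  ultimately show ?thesis by (simp add: card_image)
qed

lemma count_invariant_orbit:
  assumes "permutation T" "M \<in> invariant_multisets T S" "y \<in> orbit T x"
  shows "count M y = count M x"
proof -
  have *: "\<forall>x. count M (T x) = count M x"
    using assms(1,2) image_mset_eq_iff_count[of T M] by (simp add: invariant_multisets_def permutation)
  from assms(3) show ?thesis by (induction rule: orbit.induct) (use * in auto)
qed

text \<open>Distinct orbits are disjoint, so among the members of \<open>N\<close> only the copies
  of \<open>orbit T x\<close> contain \<open>x\<close>.\<close>

lemma count_Union_orbits:
  assumes T: "permutation T" "T ` S \<subseteq> S" and N: "set_mset N \<subseteq> orbit T ` S"
  shows "count (\<Sum>\<^sub># (image_mset mset_set N)) x = count N (orbit T x)"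
  using N
proof (induction N)
  case (add b N)
  then obtain y where "b = orbit T y" by auto
  moreover have "finite (orbit T y)" by (rule finite_orbit) (rule permutation_self_in_orbit[OF T(1)])
  ultimately have "count (mset_set b) x = (if b = orbit T x then 1 else 0)"
    using orbit_eq_iff_mem[OF T(1), of x y] by (metis count_mset_set(1,3))
  then show ?case using add by simp
qed simp

text \<open>Multiplicity is constant along orbits, so an invariant multiset amounts to one
  multiplicity per orbit. \<open>N\<close> records these, and the map replaces each orbit by the
  multiset of its points.\<close>

lemma bij_betw_orbit_multisets:
  assumes T: "permutation T" "T ` S \<subseteq> S" and "finite S"
  shows "bij_betw (\<lambda>N. \<Sum>\<^sub># (image_mset mset_set N)) {N. set_mset N \<subseteq> orbit T ` S}
           (invariant_multisets T S)"
proof (rule bij_betwI')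
  fix N N' assume N: "N \<in> {N. set_mset N \<subseteq> orbit T ` S}" "N' \<in> {N. set_mset N \<subseteq> orbit T ` S}"
  show "(\<Sum>\<^sub># (image_mset mset_set N) = \<Sum>\<^sub># (image_mset mset_set N')) = (N = N')"
  proof
    assume eq: "\<Sum>\<^sub># (image_mset mset_set N) = \<Sum>\<^sub># (image_mset mset_set N')"
    show "N = N'"
    proof (rule multiset_eqI)
      fix b
      show "count N b = count N' b"
      proof (cases "b \<in> orbit T ` S")
        case True
        then obtain x where "b = orbit T x" by auto
        then show ?thesis using count_Union_orbits[OF T] eq N by (metis mem_Collect_eq)
      next
        case False
        then have "b \<notin># N" "b \<notin># N'" using N by auto
        then show ?thesis by (simp add: not_in_iff)
      qed
    qed
  qed simp
next
  fix N assume N: "N \<in> {N. set_mset N \<subseteq> orbit T ` S}"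
  let ?M = "\<Sum>\<^sub># (image_mset mset_set N)"
  have c: "count ?M x = count N (orbit T x)" for x using count_Union_orbits[OF T] N by simp
  have "set_mset ?M \<subseteq> S"
  proof
    fix x assume "x \<in># ?M"
    then have "orbit T x \<in># N" by (metis c count_eq_zero_iff)
    then obtain y where "orbit T x = orbit T y" "y \<in> S" using N by auto
    then show "x \<in> S" using orbit_closed_subset[OF T(2)] permutation_self_in_orbit[OF T(1)] by blast
  qed
  moreover have "image_mset T ?M = ?M"
    using T(1) by (subst image_mset_eq_iff_count) (auto simp: permutation c permutation_orbit_step)
  ultimately show "?M \<in> invariant_multisets T S" by (simp add: invariant_multisets_def)
next
  fix M assume M: "M \<in> invariant_multisets T S"
  \<comment> \<open>The multiplicity is read at an arbitrary point of the orbit;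
    \<open>count_invariant_orbit\<close> makes the choice irrelevant.\<close>
  define g where "g b = count M (SOME x. x \<in> b)" for b
  define N where "N = (\<Sum>b\<in>orbit T ` S. replicate_mset (g b) b)"
  have fin: "finite (orbit T ` S)" using assms by simp
  have cN: "count N b = (if b \<in> orbit T ` S then g b else 0)" for b
    unfolding N_def count_sum using fin by (simp add: sum.delta)
  have N: "set_mset N \<subseteq> orbit T ` S"
    by (metis cN count_eq_zero_iff subsetI)
  have "M = \<Sum>\<^sub># (image_mset mset_set N)"
  proof (rule multiset_eqI)
    fix x
    have "count (\<Sum>\<^sub># (image_mset mset_set N)) x = count N (orbit T x)"
      using count_Union_orbits[OF T N] .
    also have "\<dots> = count M x"
    proof (cases "x \<in> S")
      case True
      have "(SOME y. y \<in> orbit T x) \<in> orbit T x"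
        using permutation_self_in_orbit[OF T(1)] by (metis someI)
      then have "g (orbit T x) = count M x"
        unfolding g_def by (rule count_invariant_orbit[OF T(1) M])
      then show ?thesis using True by (simp add: cN)
    next
      case False
      then have "orbit T x \<notin> orbit T ` S"
        using orbit_closed_subset[OF T(2)] permutation_self_in_orbit[OF T(1)] by blast
      moreover have "count M x = 0"
        using False M by (auto simp: invariant_multisets_def count_eq_zero_iff)
      ultimately show ?thesis by (simp add: cN)
    qed
    finally show "count M x = count (\<Sum>\<^sub># (image_mset mset_set N)) x" by simp
  qed
  with N show "\<exists>N \<in> {N. set_mset N \<subseteq> orbit T ` S}. M = \<Sum>\<^sub># (image_mset mset_set N)" by blast
qed

lemma size_Union_orbits:
  assumes "\<And>x. x \<in> S \<Longrightarrow> card (orbit T x) = s" "set_mset N \<subseteq> orbit T ` S"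
  shows "size (\<Sum>\<^sub># (image_mset mset_set N)) = size N * s"
  using assms(2) by (induction N) (use assms(1) in auto)

text \<open>Ensures that dividing a block size by the orbit size loses nothing, so that the quotient
  can serve as a label of the block.\<close>

lemma dvd_size_invariant:
  assumes T: "permutation T" "T ` S \<subseteq> S" and "finite S"
    and s: "\<And>x. x \<in> S \<Longrightarrow> card (orbit T x) = s"
    and M: "M \<in> invariant_multisets T S"
  shows "s dvd size M"
proof -
  obtain N where "set_mset N \<subseteq> orbit T ` S" "M = \<Sum>\<^sub># (image_mset mset_set N)"
    using bij_betw_orbit_multisets[OF assms(1-3)] M unfolding bij_betw_def by blast
  then show ?thesis using size_Union_orbits[where S=S and s=s and T=T, OF s] by simp
qed

text \<open>Stars and bars: a multiset of size \<open>k * s\<close> is a choice, with repetition, of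
  \<open>k\<close> among the \<open>r\<close> orbits in \<open>S\<close>. For \<open>r = 0\<close>
  the truncated subtraction still gives 1 if \<open>k = 0\<close> and 0 otherwise.\<close>

lemma card_invariant_multisets:
  assumes T: "permutation T" "T ` S \<subseteq> S" and "finite S"
    and s: "\<And>x. x \<in> S \<Longrightarrow> card (orbit T x) = s" and "s > 0"
    and r: "card S = s * r"
  shows "finite {M \<in> invariant_multisets T S. size M = k * s}"
    and "card {M \<in> invariant_multisets T S. size M = k * s} = (k + r - 1) choose k"
proof -
  let ?G = "\<lambda>N. \<Sum>\<^sub># (image_mset mset_set N)"
  let ?D = "{N. set_mset N \<subseteq> orbit T ` S}"
  have bij: "bij_betw ?G ?D (invariant_multisets T S)"
    using bij_betw_orbit_multisets[OF assms(1-3)] .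
  have sz: "size (?G N) = k * s \<longleftrightarrow> size N = k" if "N \<in> ?D" for N
    using size_Union_orbits[where S=S and s=s and T=T and N=N, OF s] that \<open>s > 0\<close> by simp
  have "?G ` multisets_of_size (orbit T ` S) k = ?G ` {N \<in> ?D. size (?G N) = k * s}"
    by (rule arg_cong[where f="image ?G"]) (use sz in \<open>auto simp only: multisets_of_size_def mem_Collect_eq\<close>)
  also have "\<dots> = {M \<in> ?G ` ?D. size M = k * s}" by blast
  finally have "?G ` multisets_of_size (orbit T ` S) k = {M \<in> invariant_multisets T S. size M = k * s}"
    using bij by (simp only: bij_betw_def)
  moreover have "inj_on ?G (multisets_of_size (orbit T ` S) k)"
    using bij unfolding multisets_of_size_def bij_betw_def by (auto intro: inj_on_subset)
  ultimately have bij': "bij_betw ?G (multisets_of_size (orbit T ` S) k)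
      {M \<in> invariant_multisets T S. size M = k * s}" by (simp add: bij_betw_def)
  have fin: "finite (orbit T ` S)" using \<open>finite S\<close> by simp
  show "finite {M \<in> invariant_multisets T S. size M = k * s}"
    using bij_betw_finite[OF bij'] finite_multisets_of_size[OF fin] by blast
  have "s * card (orbit T ` S) = s * r"
    using card_eq_card_orbits_mult[OF assms(1-3) s] r by simp
  then have "card (orbit T ` S) = r" using \<open>s > 0\<close> by simp
  then show "card {M \<in> invariant_multisets T S. size M = k * s} = (k + r - 1) choose k"
    using bij_betw_same_card[OF bij'] card_multisets_of_size[OF fin, of k] by (simp add: add.commute)
qed

section \<open>Product decomposition over invariant blocks\<close>

lemma filter_mem_invariant:
  assumes "bij T" "\<And>x. T x \<in> S \<longleftrightarrow> x \<in> S" "image_mset T M = M"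
  shows "filter_mset (\<lambda>x. x \<in> S) M \<in> invariant_multisets T S"
  using assms by (auto simp: invariant_multisets_def image_mset_eq_iff_count)

lemma count_invariant_outside:
  "M \<in> invariant_multisets T S \<Longrightarrow> x \<notin> S \<Longrightarrow> count M x = 0"
  by (auto simp: invariant_multisets_def count_eq_zero_iff)

text \<open>As \<open>T\<close> preserves each block, invariance can be tested block by block, and
  arbitrary invariant pieces on disjoint blocks are glued by adding them. Restricting to
  \<open>I\<close> makes the family of pieces a member of the extensional product.\<close>

lemma bij_betw_restrict_blocks:
  assumes "bij T" "finite I" and disj: "disjoint_family_on U I"
    and cl: "\<And>i x. i \<in> I \<Longrightarrow> T x \<in> U i \<longleftrightarrow> x \<in> U i"
  shows "bij_betw (\<lambda>M. \<lambda>i\<in>I. filter_mset (\<lambda>x. x \<in> U i) M)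
           (invariant_multisets T (\<Union>i\<in>I. U i)) (PiE I (\<lambda>i. invariant_multisets T (U i)))"
proof (rule bij_betwI')
  fix M M' assume M: "M \<in> invariant_multisets T (\<Union>i\<in>I. U i)" "M' \<in> invariant_multisets T (\<Union>i\<in>I. U i)"
  show "((\<lambda>i\<in>I. filter_mset (\<lambda>x. x \<in> U i) M) = (\<lambda>i\<in>I. filter_mset (\<lambda>x. x \<in> U i) M')) = (M = M')"
  proof
    assume eq: "(\<lambda>i\<in>I. filter_mset (\<lambda>x. x \<in> U i) M) = (\<lambda>i\<in>I. filter_mset (\<lambda>x. x \<in> U i) M')"
    show "M = M'"
    proof (rule multiset_eqI)
      fix x
      show "count M x = count M' x"
      proof (cases "x \<in> (\<Union>i\<in>I. U i)")
        case True
        then obtain i where i: "i \<in> I" "x \<in> U i" by auto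
        then have "filter_mset (\<lambda>x. x \<in> U i) M = filter_mset (\<lambda>x. x \<in> U i) M'"
          using fun_cong[OF eq, of i] by simp
        then show ?thesis using i by (metis count_filter_mset)
      next
        case False
        then show ?thesis using M by (simp add: count_invariant_outside)
      qed
    qed
  qed simp
next
  fix M assume "M \<in> invariant_multisets T (\<Union>i\<in>I. U i)"
  then show "(\<lambda>i\<in>I. filter_mset (\<lambda>x. x \<in> U i) M) \<in> (\<Pi>\<^sub>E i\<in>I. invariant_multisets T (U i))"
    using filter_mem_invariant[OF assms(1) cl] by (auto simp: invariant_multisets_def)
next
  fix G assume G: "G \<in> (\<Pi>\<^sub>E i\<in>I. invariant_multisets T (U i))"
  define M where "M = (\<Sum>i\<in>I. G i)"
  have c: "count M x = count (G i) x" if "i \<in> I" "x \<in> U i" for i x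
  proof -
    have "count (G j) x = 0" if "j \<in> I - {i}" for j
    proof -
      have "x \<notin> U j" using disj that \<open>i \<in> I\<close> \<open>x \<in> U i\<close> by (auto simp: disjoint_family_on_def)
      then show ?thesis using G that by (auto intro!: count_invariant_outside[where T=T and S="U j"])
    qed
    then show ?thesis unfolding M_def count_sum
      using \<open>i \<in> I\<close> \<open>finite I\<close> by (simp add: sum.remove)
  qed
  have "M \<in> invariant_multisets T (\<Union>i\<in>I. U i)"
  proof -
    have Gi: "image_mset T (G i) = G i" "set_mset (G i) \<subseteq> U i" if "i \<in> I" for i
      using PiE_mem[OF G that] by (simp_all add: invariant_multisets_def)
    have "image_mset T M = (\<Sum>i\<in>I. image_mset T (G i))"
      unfolding M_def using \<open>finite I\<close> by (induction I rule: finite_induct) auto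
    also have "\<dots> = M" unfolding M_def by (rule sum.cong[OF refl Gi(1)])
    finally have "image_mset T M = M" .
    moreover have "set_mset M \<subseteq> (\<Union>i\<in>I. U i)"
      unfolding M_def set_mset_sum[OF \<open>finite I\<close>] using Gi(2) by blast
    ultimately show ?thesis by (simp add: invariant_multisets_def)
  qed
  moreover have "G = (\<lambda>i\<in>I. filter_mset (\<lambda>x. x \<in> U i) M)"
  proof
    fix i
    show "G i = (\<lambda>i\<in>I. filter_mset (\<lambda>x. x \<in> U i) M) i"
    proof (cases "i \<in> I")
      case True
      have "G i = filter_mset (\<lambda>x. x \<in> U i) M"
      proof (rule multiset_eqI)
        fix x
        show "count (G i) x = count (filter_mset (\<lambda>x. x \<in> U i) M) x"
          using c[OF True, of x] G True by (auto intro!: count_invariant_outside[where T=T and S="U i"])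
      qed
      then show ?thesis using True by simp
    next
      case False then show ?thesis using G by auto
    qed
  qed
  ultimately show "\<exists>M\<in>invariant_multisets T (\<Union>i\<in>I. U i). G = (\<lambda>i\<in>I. filter_mset (\<lambda>x. x \<in> U i) M)"
    by blast
qed

text \<open>The prescribed sizes constrain each factor of the product separately, so the number is a
  product of stars-and-bars counts. Finiteness is kept beside the cardinality because the later
  union over labellings needs it.\<close>

lemma card_invariant_multisets_blocks:
  assumes T: "permutation T" "finite I" and disj: "disjoint_family_on U I"
    and cl: "\<And>i x. i \<in> I \<Longrightarrow> T x \<in> U i \<longleftrightarrow> x \<in> U i"
    and fin: "\<And>i. i \<in> I \<Longrightarrow> finite (U i)"
    and s: "\<And>i x. i \<in> I \<Longrightarrow> x \<in> U i \<Longrightarrow> card (orbit T x) = s i"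
    and s0: "\<And>i. i \<in> I \<Longrightarrow> s i > 0"
    and r: "\<And>i. i \<in> I \<Longrightarrow> card (U i) = s i * r i"
  shows "finite {M \<in> invariant_multisets T (\<Union>i\<in>I. U i).
            \<forall>i\<in>I. size (filter_mset (\<lambda>x. x \<in> U i) M) = t i * s i}"
    and "card {M \<in> invariant_multisets T (\<Union>i\<in>I. U i).
            \<forall>i\<in>I. size (filter_mset (\<lambda>x. x \<in> U i) M) = t i * s i}
         = (\<Prod>i\<in>I. (t i + r i - 1) choose t i)"
proof -
  have bT: "bij T" using T(1) by (simp add: permutation)
  let ?F = "\<lambda>M. \<lambda>i\<in>I. filter_mset (\<lambda>x. x \<in> U i) M"
  let ?X = "{M \<in> invariant_multisets T (\<Union>i\<in>I. U i).
            \<forall>i\<in>I. size (filter_mset (\<lambda>x. x \<in> U i) M) = t i * s i}"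
  let ?Y = "PiE I (\<lambda>i. {M \<in> invariant_multisets T (U i). size M = t i * s i})"
  have bij: "bij_betw ?F (invariant_multisets T (\<Union>i\<in>I. U i)) (PiE I (\<lambda>i. invariant_multisets T (U i)))"
    by (rule bij_betw_restrict_blocks) (use assms bT in auto)
  have inj: "inj_on ?F ?X"
    using bij unfolding bij_betw_def by (auto intro: inj_on_subset)
  have img: "?F ` ?X = ?Y"
  proof
    show "?F ` ?X \<subseteq> ?Y"
      using bij_betwE[OF bij] by fastforce
  next
    show "?Y \<subseteq> ?F ` ?X"
    proof
      fix G assume G: "G \<in> ?Y"
      then have "G \<in> PiE I (\<lambda>i. invariant_multisets T (U i))" by auto
      then obtain M where "M \<in> invariant_multisets T (\<Union>i\<in>I. U i)" "G = ?F M"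
        using bij unfolding bij_betw_def by blast
      then show "G \<in> ?F ` ?X" using G by fastforce
    qed
  qed
  have sub: "T ` U i \<subseteq> U i" if "i \<in> I" for i using cl[OF that] by auto
  have "bij_betw ?F ?X ?Y" using inj img by (simp add: bij_betw_def)
  note this[THEN bij_betw_finite] this[THEN bij_betw_same_card]
  moreover have "finite ?Y"
    by (intro finite_PiE T(2) card_invariant_multisets(1)[OF T(1) sub fin s s0 r])
  moreover have "card ?Y = (\<Prod>i\<in>I. (t i + r i - 1) choose t i)"
    unfolding card_PiE[OF T(2)]
    by (intro prod.cong refl card_invariant_multisets(2)[OF T(1) sub fin s s0 r])
  ultimately show "finite ?X" "card ?X = (\<Prod>i\<in>I. (t i + r i - 1) choose t i)" by auto
qed

section \<open>Labellings of blocks with a prescribed multiset of labels\<close>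

lemma card_labellings:
  assumes "finite B" "size R = card B"
  shows "finite {t \<in> B \<rightarrow>\<^sub>E UNIV. image_mset t (mset_set B) = R}"
    and "card {t \<in> B \<rightarrow>\<^sub>E UNIV. image_mset t (mset_set B) = R} = card (permutations_of_multiset R)"
proof -
  obtain bs where bs: "set bs = B" "distinct bs" using finite_distinct_list[OF assms(1)] by blast
  have m: "mset_set B = mset bs" using bs mset_set_set[of bs] by simp
  have lB: "length bs = card B" using bs by (metis distinct_card)
  let ?L = "{t \<in> B \<rightarrow>\<^sub>E UNIV. image_mset t (mset_set B) = R}"
  \<comment> \<open>A labelling is identified with the list of its values along \<open>bs\<close>.
    Extensionality outside \<open>B\<close> keeps one labelling from being counted as many
    functions.\<close>
  have "bij_betw (\<lambda>t. map t bs) ?L (permutations_of_multiset R)"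
  proof (rule bij_betwI')
    fix t t' assume "t \<in> ?L" "t' \<in> ?L"
    then have t: "t \<in> B \<rightarrow>\<^sub>E UNIV" "t' \<in> B \<rightarrow>\<^sub>E UNIV" by blast+
    have "t = t'" if "map t bs = map t' bs"
      by (rule PiE_ext[OF t]) (use that bs in simp)
    then show "(map t bs = map t' bs) = (t = t')" by blast
  next
    fix t assume "t \<in> ?L"
    then show "map t bs \<in> permutations_of_multiset R"
      by (simp add: permutations_of_multiset_def m)
  next
    fix xs assume "xs \<in> permutations_of_multiset R"
    then have xs: "mset xs = R" by (simp add: permutations_of_multiset_def)
    then have len: "length bs = length xs" using lB assms(2) by (metis size_mset)
    define t where "t = restrict (\<lambda>b. the (map_of (zip bs xs) b)) B"
    have mt: "map t bs = xs"
    proof (rule nth_equalityI)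
      fix i assume "i < length (map t bs)"
      then have i: "i < length bs" by simp
      then have "bs ! i \<in> B" using bs nth_mem by blast
      then show "map t bs ! i = xs ! i"
        using i map_of_zip_nth[OF len bs(2)] len by (simp add: t_def)
    qed (simp add: len)
    moreover have "image_mset t (mset_set B) = R"
      using mt xs m by (metis mset_map)
    moreover have "t \<in> B \<rightarrow>\<^sub>E UNIV" by (simp add: t_def)
    ultimately show "\<exists>t\<in>?L. xs = map t bs" by blast
  qed
  note this[THEN bij_betw_finite] this[THEN bij_betw_same_card]
  then show "finite ?L" "card ?L = card (permutations_of_multiset R)" by auto
qed

lemma filter_pos_mset_pad_zero:
  fixes Q :: "nat multiset"
  assumes "0 \<notin># Q"
  shows "filter_mset (\<lambda>k. k > 0) (Q + replicate_mset m 0) = Q"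
proof (rule multiset_eqI)
  fix x
  show "count (filter_mset (\<lambda>k. k > 0) (Q + replicate_mset m 0)) x = count Q x"
    using assms by (cases "x = 0") (simp_all add: not_in_iff)
qed

lemma filter_pos_mset_split:
  "filter_mset (\<lambda>k. k > 0) N + replicate_mset (count N 0) 0 = (N :: nat multiset)"
  by (rule multiset_eqI) auto

text \<open>Once the total number of labels is known, prescribing the positive ones prescribes all
  of them; this turns the filter into an equation of multisets.\<close>

lemma filter_pos_mset_eq_iff:
  fixes N Q :: "nat multiset"
  assumes "0 \<notin># Q" "size Q \<le> size N"
  shows "filter_mset (\<lambda>k. k > 0) N = Q \<longleftrightarrow> N = Q + replicate_mset (size N - size Q) 0" (is "?l \<longleftrightarrow> ?r")
proof
  assume ?l
  then have split: "Q + replicate_mset (count N 0) 0 = N"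
    using filter_pos_mset_split[of N] by simp
  have "size N - size Q = count N 0"
    using arg_cong[OF split, of size] by simp
  then show ?r using split by simp
next
  assume ?r
  then obtain m where "N = Q + replicate_mset m 0" ..
  then show ?l using filter_pos_mset_pad_zero[OF assms(1)] by simp
qed

text \<open>A multinomial coefficient. With \<open>m\<close> the number of untiled blocks it becomes
  \<open>orbit_choices\<close>, and \<open>fact m\<close> accounts for these blocks being
  interchangeable.\<close>

lemma real_card_permutations_pad_zero:
  fixes Q :: "nat multiset"
  assumes "0 \<notin># Q"
  shows "real (card (permutations_of_multiset (Q + replicate_mset m 0))) =
    fact (size Q + m) / (fact m * (\<Prod>q\<in>set_mset Q. fact (count Q q)))"
proof -
  let ?R = "Q + replicate_mset m 0"
  have "card (permutations_of_multiset ?R) * (\<Prod>x\<in>set_mset ?R. fact (count ?R x)) = fact (size Q + m)"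
    using card_permutations_of_multiset_aux[of ?R] by simp
  moreover have "(\<Prod>x\<in>set_mset ?R. fact (count ?R x) :: nat) = fact m * (\<Prod>q\<in>set_mset Q. fact (count Q q))"
  proof -
    have "(\<Prod>x\<in>set_mset ?R. fact (count ?R x) :: nat) = (\<Prod>x\<in>insert 0 (set_mset Q). fact (count ?R x))"
      by (rule prod.mono_neutral_left) (auto split: if_splits simp: not_in_iff)
    also have "\<dots> = fact (count ?R 0) * (\<Prod>x\<in>set_mset Q. fact (count ?R x))"
      using assms by simp
    also have "(\<Prod>x\<in>set_mset Q. fact (count ?R x) :: nat) = (\<Prod>q\<in>set_mset Q. fact (count Q q))"
      by (rule prod.cong) (use assms in \<open>auto\<close>)
    also have "count ?R 0 = m" using assms by (simp add: not_in_iff)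
    finally show ?thesis .
  qed
  ultimately have "real (card (permutations_of_multiset ?R) * (fact m * (\<Prod>q\<in>set_mset Q. fact (count Q q)))) = fact (size Q + m)"
    by (metis of_nat_fact)
  then show ?thesis by (simp add: field_simps)
qed

text \<open>Blocks in \<open>A\<close> and \<open>C\<close> have the fixed labels \<open>l\<close>
  and \<open>n\<close>, while those in \<open>B\<close> receive any arrangement of \<open>Q\<close>
  padded with zeros. All arrangements lead to the same product of binomial coefficients, so the
  count is their number times this product. The exponents \<open>card A\<close> and
  \<open>card C\<close> cover absent eigenlines by empty products.\<close>

lemma card_invariant_multisets_labelled:
  fixes U :: "'i \<Rightarrow> 'b set" and s r :: "'i \<Rightarrow> nat" and l n :: nat
  assumes T: "permutation T" and fI: "finite I" and disj: "disjoint_family_on U I"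
    and cl: "\<And>i x. i \<in> I \<Longrightarrow> T x \<in> U i \<longleftrightarrow> x \<in> U i"
    and fin: "\<And>i. i \<in> I \<Longrightarrow> finite (U i)"
    and s: "\<And>i x. i \<in> I \<Longrightarrow> x \<in> U i \<Longrightarrow> card (orbit T x) = s i"
    and s0: "\<And>i. i \<in> I \<Longrightarrow> s i > 0"
    and r: "\<And>i. i \<in> I \<Longrightarrow> card (U i) = s i * r i"
    and I: "I = A \<union> C \<union> B" "A \<inter> C = {}" "A \<inter> B = {}" "C \<inter> B = {}"
    and rA: "\<And>i. i \<in> A \<Longrightarrow> r i = a" and rC: "\<And>i. i \<in> C \<Longrightarrow> r i = c" and rB: "\<And>i. i \<in> B \<Longrightarrow> r i = b"
    and Q: "0 \<notin># Q" "size Q \<le> card B"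
  defines "X \<equiv> {M \<in> invariant_multisets T (\<Union>i\<in>I. U i).
      (\<forall>i\<in>A. size (filter_mset (\<lambda>x. x \<in> U i) M) = l * s i) \<and>
      (\<forall>i\<in>C. size (filter_mset (\<lambda>x. x \<in> U i) M) = n * s i) \<and>
      filter_mset (\<lambda>k. k > 0)
        (image_mset (\<lambda>i. size (filter_mset (\<lambda>x. x \<in> U i) M) div s i) (mset_set B)) = Q}"
  shows "finite X"
    and "real (card X) =
      fact (card B) / (fact (card B - size Q) * (\<Prod>q\<in>set_mset Q. fact (count Q q))) *
      real ((l + a - 1) choose l) ^ card A * real ((n + c - 1) choose n) ^ card C *
      (\<Prod>q\<in>set_mset Q. real ((q + b - 1) choose q) ^ count Q q)"
proof -
  define R where "R = Q + replicate_mset (card B - size Q) 0"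
  define L where "L = {t \<in> B \<rightarrow>\<^sub>E UNIV. image_mset t (mset_set B) = R}"
  define ext where "ext t i = (if i \<in> A then l else if i \<in> C then n else t i)" for t i
  define sz where "sz M i = size (filter_mset (\<lambda>x. x \<in> U i) M)" for M i
  define Y where "Y t = {M \<in> invariant_multisets T (\<Union>i\<in>I. U i). \<forall>i\<in>I. sz M i = ext t i * s i}" for t
  have finABC: "finite A" "finite B" "finite C" using fI I by auto
  have szR: "size R = card B" using Q by (simp add: R_def)
  note finL = card_labellings(1)[OF finABC(2) szR, folded L_def]
  note cardL = card_labellings(2)[OF finABC(2) szR, folded L_def]
  have bT: "bij T" using T by (simp add: permutation)
  have dvd: "s i dvd sz M i" if "M \<in> invariant_multisets T (\<Union>i\<in>I. U i)" "i \<in> I" for M i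
    unfolding sz_def
  proof (rule dvd_size_invariant[OF T _ fin[OF that(2)] s[OF that(2)]])
    show "T ` U i \<subseteq> U i" using cl[OF that(2)] by auto
    show "filter_mset (\<lambda>x. x \<in> U i) M \<in> invariant_multisets T (U i)"
      by (rule filter_mem_invariant[OF bT cl[OF that(2)]])
         (use that(1) in \<open>simp add: invariant_multisets_def\<close>)
  qed
  have Q_iff: "filter_mset (\<lambda>k. k > 0) (image_mset f (mset_set B)) = Q \<longleftrightarrow> image_mset f (mset_set B) = R" for f
    using filter_pos_mset_eq_iff[of Q "image_mset f (mset_set B)"] Q by (simp add: R_def)
  have imB: "image_mset f (mset_set B) = image_mset g (mset_set B)" if "\<And>i. i \<in> B \<Longrightarrow> f i = g i" for f g :: "'i \<Rightarrow> nat"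
    by (rule image_mset_cong) (use that finABC in auto)
  have X_eq: "X = (\<Union>t\<in>L. Y t)"
  proof (intro equalityI subsetI)
    fix M assume M: "M \<in> X"
    then have inv: "M \<in> invariant_multisets T (\<Union>i\<in>I. U i)" by (simp add: X_def)
    define t where "t = (\<lambda>i\<in>B. sz M i div s i)"
    have "image_mset t (mset_set B) = image_mset (\<lambda>i. sz M i div s i) (mset_set B)"
      by (rule imB) (simp add: t_def)
    then have "t \<in> L" using M Q_iff unfolding L_def X_def by (simp add: t_def sz_def)
    moreover have "sz M i = ext t i * s i" if "i \<in> I" for i
      using that M dvd[OF inv that] I
      by (cases "i \<in> A \<or> i \<in> C") (auto simp: X_def ext_def t_def sz_def)
    ultimately show "M \<in> (\<Union>t\<in>L. Y t)" using inv unfolding Y_def by blast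
  next
    fix M assume "M \<in> (\<Union>t\<in>L. Y t)"
    then obtain t where t: "t \<in> L" "M \<in> Y t" by blast
    have "sz M i div s i = t i" if "i \<in> B" for i
      using t(2) that I s0[of i] by (auto simp: Y_def ext_def)
    then have "image_mset (\<lambda>i. sz M i div s i) (mset_set B) = R"
      using imB[of "\<lambda>i. sz M i div s i" t] t(1) by (simp add: L_def)
    moreover have "sz M i = l * s i" if "i \<in> A" for i
      using t(2) that I by (auto simp: Y_def ext_def)
    moreover have "sz M i = n * s i" if "i \<in> C" for i
      using t(2) that I by (auto simp: Y_def ext_def)
    ultimately show "M \<in> X" using t(2) Q_iff unfolding X_def Y_def sz_def by blast
  qed
  note blocks = card_invariant_multisets_blocks[OF T fI disj cl fin s s0 r, of "ext t" for t]
  have finY: "finite (Y t)" for t unfolding Y_def sz_def by (rule blocks(1))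
  have disjY: "Y t \<inter> Y t' = {}" if "t \<in> L" "t' \<in> L" "t \<noteq> t'" for t t'
  proof (rule ccontr)
    assume "Y t \<inter> Y t' \<noteq> {}"
    then obtain M where M: "M \<in> Y t" "M \<in> Y t'" by blast
    have "t i = t' i" if "i \<in> B" for i
    proof -
      have "i \<notin> A" "i \<notin> C" "i \<in> I" using that I by auto
      then have "sz M i = t i * s i" "sz M i = t' i * s i" using M by (auto simp: Y_def ext_def)
      then show ?thesis using s0[OF \<open>i \<in> I\<close>] by simp
    qed
    moreover have "t \<in> B \<rightarrow>\<^sub>E UNIV" "t' \<in> B \<rightarrow>\<^sub>E UNIV" using that by (auto simp only: L_def mem_Collect_eq)
    ultimately show False using PiE_ext \<open>t \<noteq> t'\<close> by metis
  qed
  let ?g = "\<lambda>q. (q + b - 1) choose q"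
  let ?K = "((l + a - 1) choose l) ^ card A * ((n + c - 1) choose n) ^ card C * (\<Prod>q\<in>set_mset Q. ?g q ^ count Q q)"
  have cardY: "card (Y t) = ?K" if "t \<in> L" for t
  proof -
    have "card (Y t) = (\<Prod>i\<in>I. (ext t i + r i - 1) choose ext t i)"
      unfolding Y_def sz_def by (rule blocks(2))
    also have "\<dots> = (\<Prod>i\<in>A. (ext t i + r i - 1) choose ext t i) *
        (\<Prod>i\<in>C. (ext t i + r i - 1) choose ext t i) * (\<Prod>i\<in>B. (ext t i + r i - 1) choose ext t i)"
      using I finABC by (simp add: prod.union_disjoint Int_Un_distrib2)
    also have "(\<Prod>i\<in>A. (ext t i + r i - 1) choose ext t i) = (\<Prod>i\<in>A. (l + a - 1) choose l)"
      by (rule prod.cong) (auto simp: ext_def rA)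
    also have "(\<Prod>i\<in>C. (ext t i + r i - 1) choose ext t i) = (\<Prod>i\<in>C. (n + c - 1) choose n)"
      by (rule prod.cong) (use I in \<open>auto simp: ext_def rC\<close>)
    also have "(\<Prod>i\<in>B. (ext t i + r i - 1) choose ext t i) = (\<Prod>i\<in>B. ?g (t i))"
      by (rule prod.cong) (use I in \<open>auto simp: ext_def rB\<close>)
    also have "(\<Prod>i\<in>B. ?g (t i)) = prod_mset (image_mset ?g (image_mset t (mset_set B)))"
      by (simp add: prod_unfold_prod_mset multiset.map_comp comp_def)
    also have "image_mset t (mset_set B) = R" using that by (simp add: L_def)
    \<comment> \<open>Only the labels in \<open>Q\<close> survive: each padding label 0 contributes
      \<open>(0 + b - 1) choose 0\<close>, which is 1.\<close>
    also have "prod_mset (image_mset ?g R) = (\<Prod>q\<in>set_mset Q. ?g q ^ count Q q)"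
      by (simp add: R_def image_prod_mset_multiplicity)
    finally show ?thesis by simp
  qed
  show "finite X" unfolding X_eq using finL finY by blast
  have "card X = (\<Sum>t\<in>L. card (Y t))"
    unfolding X_eq by (rule card_UN_disjoint) (use finL finY disjY in auto)
  also have "\<dots> = card L * ?K" using cardY by simp
  finally have "real (card X) = real (card (permutations_of_multiset R)) * real ?K"
    by (simp add: cardL)
  also have "real (card (permutations_of_multiset R)) =
      fact (card B) / (fact (card B - size Q) * (\<Prod>q\<in>set_mset Q. fact (count Q q)))"
    unfolding R_def real_card_permutations_pad_zero[OF Q(1)] using Q(2) by simp
  finally show "real (card X) =
      fact (card B) / (fact (card B - size Q) * (\<Prod>q\<in>set_mset Q. fact (count Q q))) *
      real ((l + a - 1) choose l) ^ card A * real ((n + c - 1) choose n) ^ card C *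
      (\<Prod>q\<in>set_mset Q. real ((q + b - 1) choose q) ^ count Q q)"
    by simp
qed

text \<open>Division with remainder: the exponents satisfying \<open>P\<close> contain 0 and are
  closed under adding and cancelling, so they are the multiples of the least positive one. Matrix
  order, central indicator and multiplicative order are instances.\<close>

lemma Least_pos_dvd_iff:
  fixes P :: "nat \<Rightarrow> bool"
  assumes "k > 0" "P k" and "P 0"
    and add: "\<And>m n. P m \<Longrightarrow> P (m + n) \<longleftrightarrow> P n"
  shows "(LEAST k. k > 0 \<and> P k) > 0" and "P j \<longleftrightarrow> (LEAST k. k > 0 \<and> P k) dvd j"
proof -
  define d where "d = (LEAST k. k > 0 \<and> P k)"
  have d: "d > 0 \<and> P d"
    unfolding d_def using assms(1,2) by (intro LeastI[of "\<lambda>k. k > 0 \<and> P k" k]) simp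
  have least: "\<not> P m" if "0 < m" "m < d" for m
    using not_less_Least[of m "\<lambda>k. k > 0 \<and> P k"] that by (simp add: d_def)
  have mult: "P (m * d)" for m
  proof (induction m)
    case (Suc m) then show ?case using add[of d "m * d"] d by simp
  qed (simp add: \<open>P 0\<close>)
  have "P j \<longleftrightarrow> P (j mod d)"
    using add[OF mult[of "j div d"], of "j mod d"] by simp
  also have "\<dots> \<longleftrightarrow> j mod d = 0"
    using least[of "j mod d"] d \<open>P 0\<close> by (metis gr0I mod_less_divisor)
  finally show "P j \<longleftrightarrow> (LEAST k. k > 0 \<and> P k) dvd j"
    by (simp add: d_def dvd_eq_mod_eq_0)
  show "(LEAST k. k > 0 \<and> P k) > 0" using d by (simp add: d_def)
qed

text \<open>Finitely many self-maps force two iterates to agree, and injectivity cancels the common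
  part.\<close>

lemma funpow_eq_id_finite:
  fixes f :: "'b::finite \<Rightarrow> 'b"
  assumes "inj f"
  obtains k where "k > 0" "f ^^ k = id"
proof -
  have "\<not> inj (\<lambda>k::nat. f ^^ k)"
    using finite_imageD[of "\<lambda>k::nat. f ^^ k" UNIV] finite[of "range (\<lambda>k::nat. f ^^ k)"] infinite_UNIV_nat by metis
  then obtain i j :: nat where "f ^^ i = f ^^ j" "i < j"
    by (metis injI linorder_neqE_nat)
  have "(f ^^ (j - i)) x = x" for x
  proof -
    have "(f ^^ i) ((f ^^ (j - i)) x) = (f ^^ i) x"
      using \<open>f ^^ i = f ^^ j\<close> \<open>i < j\<close> by (metis comp_apply funpow_add le_add_diff_inverse less_imp_le)
    then show ?thesis using inj_fn[OF assms, of i] by (simp add: inj_eq)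
  qed
  then show thesis using that[of "j - i"] \<open>i < j\<close> by (simp add: fun_eq_iff)
qed

lemma permutation_finite: "bij f \<Longrightarrow> permutation f" for f :: "'b::finite \<Rightarrow> 'b"
  by (simp add: permutation)

lemma mem_iff_of_closed:
  assumes "inj T" "finite S" "T ` S \<subseteq> S"
  shows "T x \<in> S \<longleftrightarrow> x \<in> S"
proof -
  have "T ` S = S" using assms by (simp add: endo_inj_surj inj_on_subset)
  then show ?thesis using inj_image_mem_iff[OF assms(1), of x S] by simp
qed

lemma image_funpow: "(image f ^^ k) S = (f ^^ k) ` S" for f :: "'b \<Rightarrow> 'b"
  by (induction k) (auto simp: image_comp)


section \<open>Lines\<close>

lemma mem_span_single_iff: "x \<in> vec.span {v} \<longleftrightarrow> (\<exists>c. x = c *s v)" for v :: "'a::field^2"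
  by (auto simp: vec.span_singleton)

lemma span_pair_UNIV:
  fixes v w :: "'a::field^2"
  assumes "v \<noteq> 0" "w \<notin> vec.span {v}"
  shows "vec.span {v, w} = UNIV"
proof -
  have "w \<noteq> v" using assms(2) vec.span_base[of v "{v}"] by auto
  have "vec.independent {v, w}"
    using assms \<open>w \<noteq> v\<close> vec.independent_insert[of w "{v}"] by (simp add: insert_commute)
  moreover have "vec.dim (UNIV :: ('a^2) set) \<le> card {v, w}"
    unfolding vec_dim_card using \<open>w \<noteq> v\<close> by simp
  ultimately show ?thesis using vec.card_ge_dim_independent[of "{v, w}" UNIV] by blast
qed

lemma decompose_pair:
  fixes v w :: "'a::field^2"
  assumes "v \<noteq> 0" "w \<notin> vec.span {v}"
  obtains a b where "x = a *s v + b *s w"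
proof -
  have "x \<in> vec.span (insert w {v})" using span_pair_UNIV[OF assms] by (simp add: insert_commute)
  then obtain b where "x - b *s w \<in> vec.span {v}" by (auto simp only: vec.span_breakdown_eq)
  then obtain a where "x - b *s w = a *s v" by (auto simp: mem_span_single_iff)
  then have "x = a *s v + b *s w" by (metis diff_add_cancel)
  then show thesis by (rule that)
qed

lemma span_single_ne_UNIV: "vec.span {v} \<noteq> UNIV" for v :: "'a::field^2"
proof
  assume "vec.span {v} = UNIV"
  then have "vec.dim (UNIV :: ('a^2) set) = vec.dim {v}" by (metis vec.dim_span)
  then show False by (simp only: vec_dim_card vec.dim_singleton) (auto split: if_splits)
qed

lemma lines_iff: "L \<in> lines \<longleftrightarrow> (\<exists>v. v \<noteq> 0 \<and> L = vec.span {v})"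
proof
  assume "L \<in> lines"
  then have L: "vec.subspace L" "vec.dim L = 1" by (simp_all add: lines_def)
  obtain B where B: "B \<subseteq> L" "vec.independent B" "L \<subseteq> vec.span B" "card B = vec.dim L"
    by (rule vec.basis_exists)
  then obtain v where v: "B = {v}" using L(2) by (metis card_1_singletonE)
  have "L = vec.span {v}" using B v vec.span_minimal[OF B(1) L(1)] by blast
  moreover have "v \<noteq> 0" using B(2) v vec.dependent_zero[of B] by blast
  ultimately show "\<exists>v. v \<noteq> 0 \<and> L = vec.span {v}" by blast
next
  assume "\<exists>v. v \<noteq> 0 \<and> L = vec.span {v}"
  then show "L \<in> lines" unfolding lines_def by (auto simp: vec.subspace_span)
qed

lemma lines_eq_span:
  assumes "L \<in> lines" "v \<in> L" "v \<noteq> 0"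
  shows "L = vec.span {v}"
proof -
  obtain u where u: "u \<noteq> 0" "L = vec.span {u}" using assms(1) lines_iff by blast
  obtain c where c: "v = c *s u" using assms(2) u(2) by (auto simp: mem_span_single_iff)
  then have "c \<noteq> 0" using assms(3) by auto
  then have "u = inverse c *s v" using c by (simp add: vector_smult_assoc)
  then have "u \<in> vec.span {v}" by (auto simp: mem_span_single_iff)
  then have "vec.span {u} \<subseteq> vec.span {v}" by (simp add: vec.span_minimal vec.subspace_span)
  moreover have "vec.span {v} \<subseteq> vec.span {u}"
    using assms(2) u(2) by (simp add: vec.span_minimal vec.subspace_span)
  ultimately show ?thesis using u by blast
qed

lemma span_single_in_lines: "v \<noteq> 0 \<Longrightarrow> vec.span {v} \<in> lines"
  using lines_iff by blast

lemma mem_span_self: "v \<in> vec.span {v}"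
  by (simp add: vec.span_base)

lemma lines_eq_of_common:
  assumes "L \<in> lines" "L' \<in> lines" "v \<in> L" "v \<in> L'" "v \<noteq> 0"
  shows "L = L'"
  using assms lines_eq_span by metis

lemma zero_in_lines: "L \<in> lines \<Longrightarrow> 0 \<in> L"
  unfolding lines_def by (auto intro: vec.subspace_0)

lemma lines_nonzero: "L \<in> lines \<Longrightarrow> \<exists>v\<in>L. v \<noteq> 0"
  using lines_iff mem_span_self by blast

lemma card_line_nonzero:
  fixes L :: "('a::{field,finite}^2) set"
  assumes "L \<in> lines"
  shows "card (L - {0}) = CARD('a) - 1"
proof -
  obtain v where v: "v \<noteq> 0" "L = vec.span {v}" using assms lines_iff by blast
  have "inj (\<lambda>c. c *s v)" using v(1) by (auto intro!: injI)
  then have "card L = CARD('a)" unfolding v(2) vec.span_singleton by (rule card_image)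
  then show ?thesis using zero_in_lines[OF assms] by (simp add: card_Diff_singleton)
qed

lemma card_Union_lines:
  fixes S :: "('a::{field,finite}^2) set set"
  assumes "S \<subseteq> lines"
  shows "card (\<Union>S - {0}) = card S * (CARD('a) - 1)"
proof -
  have "\<Union>S - {0} = (\<Union>L\<in>S. L - {0})" by blast
  also have "card \<dots> = (\<Sum>L\<in>S. card (L - {0}))"
  proof (rule card_UN_disjoint)
    show "\<forall>L\<in>S. \<forall>L'\<in>S. L \<noteq> L' \<longrightarrow> (L - {0}) \<inter> (L' - {0}) = {}"
      using lines_eq_of_common assms by blast
  qed auto
  also have "\<dots> = (\<Sum>L\<in>S. CARD('a) - 1)"
    by (rule sum.cong) (use assms card_line_nonzero in auto)
  finally show ?thesis by simp
qed

lemma Union_lines: "\<Union>lines - {0} = UNIV - {0}"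
  using span_single_in_lines mem_span_self by blast

text \<open>With p the size of the field, the lines divide the p^2 - 1 non-zero vectors into classes
  of p - 1; cancelling p - 1 leaves p + 1.\<close>

lemma card_lines: "card (lines :: ('a::{field,finite}^2) set set) = CARD('a) + 1"
proof -
  have gt: "CARD('a) > 1"
  proof -
    have "card {0, 1 :: 'a} \<le> CARD('a)" by (rule card_mono) auto
    then show ?thesis by simp
  qed
  have "card (lines :: ('a^2) set set) * (CARD('a) - 1) = CARD('a) ^ 2 - 1"
    using card_Union_lines[of "lines :: ('a^2) set set"] unfolding Union_lines
    by (simp add: card_Diff_singleton)
  also have "\<dots> = (CARD('a) + 1) * (CARD('a) - 1)"
    using gt by (cases "CARD('a)") (simp_all add: power2_eq_square)
  finally have "card (lines :: ('a^2) set set) * (CARD('a) - 1) = (CARD('a) + 1) * (CARD('a) - 1)" .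
  moreover have "CARD('a) - 1 \<noteq> 0" using gt by simp
  ultimately show ?thesis using mult_right_cancel[of "CARD('a) - 1"] by blast
qed


section \<open>Powers\<close>

lemma mat_mult_vec: "mat c *v v = c *s v" for v :: "'a::field^2"
  by (simp add: vec_eq_iff matrix_vector_mult_def mat_def if_distrib if_distribR cong: if_cong)

lemma eq_mat_iff: "A = mat c \<longleftrightarrow> (\<forall>v. A *v v = c *s v)" for A :: "'a::field^2^2"
  by (simp add: matrix_eq mat_mult_vec)

lemma matrix_power_vec: "matrix_power A k *v v = ((*v) A ^^ k) v"
proof -
  have "((\<lambda>B. A ** B) ^^ k) (mat 1) *v v = ((*v) A ^^ k) v"
    by (induction k) (simp_all add: matrix_vector_mul_lid flip: matrix_vector_mul_assoc)
  then show ?thesis by (simp add: matrix_power_def)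
qed

lemma funpow_matrix_smult: "((*v) A ^^ k) (c *s v) = c *s ((*v) A ^^ k) v" for A :: "'a::field^2^2"
  by (simp flip: matrix_power_vec add: vector_scalar_commute)

lemma matrix_power_eq_1_iff: "matrix_power A k = mat 1 \<longleftrightarrow> (*v) A ^^ k = id"
  by (simp add: matrix_eq matrix_power_vec fun_eq_iff matrix_vector_mul_lid)

lemma central_matrix_power_iff:
  "central (matrix_power A k) \<longleftrightarrow> (\<exists>c. c \<noteq> 0 \<and> (\<forall>v. ((*v) A ^^ k) v = c *s v))"
  unfolding central_def eq_mat_iff by (simp add: matrix_power_vec)

context
  fixes A :: "'a::{field,finite}^2^2"
  assumes inv: "invertible A"
begin

lemma bij_matrix: "bij ((*v) A)"
  using inv invertible_eq_bij by blast

lemma inj_matrix: "inj ((*v) A)"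
  using bij_matrix by (rule bij_is_inj)

lemma matrix_vec_eq_0_iff: "A *v v = 0 \<longleftrightarrow> v = 0"
  using inj_matrix by (metis inj_eq vec.zero)

lemma matrix_order_pos: "matrix_order A > 0"
  and matrix_power_eq_1_iff_dvd: "matrix_power A j = mat 1 \<longleftrightarrow> matrix_order A dvd j"
proof -
  obtain k where k: "k > 0" "(*v) A ^^ k = id" by (rule funpow_eq_id_finite[OF inj_matrix])
  have 1: "matrix_power A k = mat 1" using k by (simp add: matrix_power_eq_1_iff)
  have 2: "matrix_power A 0 = mat 1" by (simp add: matrix_power_eq_1_iff)
  have 3: "matrix_power A (m + n) = mat 1 \<longleftrightarrow> matrix_power A n = mat 1" if "matrix_power A m = mat 1" for m n
    using that by (simp add: matrix_power_eq_1_iff funpow_add)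
  show "matrix_order A > 0" unfolding matrix_order_def
    by (rule Least_pos_dvd_iff(1)[where P="\<lambda>k. matrix_power A k = mat 1", OF k(1) 1 2 3])
  show "matrix_power A j = mat 1 \<longleftrightarrow> matrix_order A dvd j" unfolding matrix_order_def
    by (rule Least_pos_dvd_iff(2)[where P="\<lambda>k. matrix_power A k = mat 1", OF k(1) 1 2 3])
qed

lemma central_of_power_1: "matrix_power A j = mat 1 \<Longrightarrow> central (matrix_power A j)"
  unfolding central_def by (rule exI[of _ 1]) simp

lemma central_indicator_pos: "central_indicator A > 0"
  and central_power_iff_dvd: "central (matrix_power A j) \<longleftrightarrow> central_indicator A dvd j"
proof -
  have 1: "central (matrix_power A (matrix_order A))"
    using central_of_power_1 matrix_power_eq_1_iff_dvd by simp
  have 2: "central (matrix_power A 0)"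
    using central_of_power_1 matrix_power_eq_1_iff_dvd by simp
  \<comment> \<open>A power that is a non-zero scalar can be multiplied onto another power or
    divided out of it, so central exponents are closed under addition and cancellation.\<close>
  have 3: "central (matrix_power A (m + n)) \<longleftrightarrow> central (matrix_power A n)" if "central (matrix_power A m)" for m n
  proof -
    obtain c where c: "c \<noteq> 0" "\<And>v. ((*v) A ^^ m) v = c *s v" using \<open>central (matrix_power A m)\<close> by (auto simp: central_matrix_power_iff)
    have e: "((*v) A ^^ (m + n)) v = c *s (((*v) A ^^ n) v)" for v by (simp add: funpow_add c(2))
    show ?thesis
    proof
      assume "central (matrix_power A (m + n))"
      then obtain b where b: "b \<noteq> 0" "\<And>v. ((*v) A ^^ (m + n)) v = b *s v" by (auto simp: central_matrix_power_iff)
      have "((*v) A ^^ n) v = (inverse c * b) *s v" for v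
      proof -
        have "inverse c *s (c *s (((*v) A ^^ n) v)) = inverse c *s (b *s v)" using b(2) e by simp
        then show ?thesis using c(1) by (simp add: vector_smult_assoc)
      qed
      then show "central (matrix_power A n)" unfolding central_matrix_power_iff
        using b(1) c(1) by (intro exI[of _ "inverse c * b"]) simp
    next
      assume "central (matrix_power A n)"
      then obtain b where b: "b \<noteq> 0" "\<And>v. ((*v) A ^^ n) v = b *s v" by (auto simp: central_matrix_power_iff)
      then show "central (matrix_power A (m + n))" unfolding central_matrix_power_iff
        using c(1) e by (intro exI[of _ "c * b"]) (simp add: vector_smult_assoc)
    qed
  qed
  show "central_indicator A > 0" unfolding central_indicator_def
    by (rule Least_pos_dvd_iff(1)[where P="\<lambda>k. central (matrix_power A k)", OF matrix_order_pos 1 2 3])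
  show "central (matrix_power A j) \<longleftrightarrow> central_indicator A dvd j" unfolding central_indicator_def
    by (rule Least_pos_dvd_iff(2)[where P="\<lambda>k. central (matrix_power A k)", OF matrix_order_pos 1 2 3])
qed

lemma order_eq_indicator_mult_quotient: "matrix_order A = central_indicator A * central_quotient A"
proof -
  have "central_indicator A dvd matrix_order A"
    using central_of_power_1 matrix_power_eq_1_iff_dvd central_power_iff_dvd by simp
  then show ?thesis by (simp add: central_quotient_def)
qed

lemma central_quotient_pos: "central_quotient A > 0"
  using matrix_order_pos order_eq_indicator_mult_quotient by (metis gr0I mult_0_right)

lemma central_iff_indicator: "central A \<longleftrightarrow> central_indicator A = 1"
proof -
  have "matrix_power A 1 = A" by (simp add: matrix_power_def)
  then show ?thesis using central_power_iff_dvd[of 1] by simp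
qed

text \<open>The alternative \<open>central A\<close> lets central matrices share the treatment of
  non-eigenlines: their indicator is 1, and every line is an orbit by itself.\<close>

lemma power_stabilizes_line_iff:
  assumes "v \<noteq> 0" and nc: "central A \<or> A *v v \<notin> vec.span {v}"
  shows "((*v) A ^^ j) v \<in> vec.span {v} \<longleftrightarrow> central_indicator A dvd j"
proof
  assume "central_indicator A dvd j"
  then show "((*v) A ^^ j) v \<in> vec.span {v}"
    using central_power_iff_dvd[of j] unfolding central_matrix_power_iff mem_span_single_iff by blast
next
  assume st: "((*v) A ^^ j) v \<in> vec.span {v}"
  show "central_indicator A dvd j"
  proof (cases "central A")
    case True
    then show ?thesis using central_iff_indicator by simp
  next
    case False
    then have w: "A *v v \<notin> vec.span {v}" using nc by simp
    obtain c where c: "((*v) A ^^ j) v = c *s v" using st mem_span_single_iff by blast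
    \<comment> \<open>\<open>A\<close> commutes with its powers, so the scalar by which
      \<open>A^j\<close> acts on \<open>v\<close> carries over to \<open>A *v v\<close>.\<close>
    have c2: "((*v) A ^^ j) (A *v v) = c *s (A *v v)"
      using c funpow_swap1[of "(*v) A" j v] by (simp add: vector_scalar_commute)
    have all: "((*v) A ^^ j) x = c *s x" for x
    proof -
      obtain a b where x: "x = a *s v + b *s (A *v v)" using decompose_pair[OF assms(1) w] .
      have "((*v) A ^^ j) x = a *s ((*v) A ^^ j) v + b *s ((*v) A ^^ j) (A *v v)"
        unfolding x by (simp add: matrix_vector_right_distrib vector_scalar_commute flip: matrix_power_vec)
      also have "\<dots> = c *s x" unfolding c c2 x
        by (simp add: vector_smult_assoc vector_add_ldistrib mult.commute)
      finally show ?thesis .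
    qed
    \<comment> \<open>\<open>central\<close> asks for a non-zero scalar; injectivity of
      \<open>A^j\<close> supplies it.\<close>
    have "c \<noteq> 0"
    proof
      assume "c = 0"
      then have "((*v) A ^^ j) v = ((*v) A ^^ j) 0" using all by simp
      then show False using inj_fn[OF inj_matrix, of j] assms(1) by (metis injD)
    qed
    then show ?thesis using all central_power_iff_dvd unfolding central_matrix_power_iff by blast
  qed
qed

text \<open>A power fixing \<open>v\<close> stabilises its line and is therefore scalar; the scalar
  must be 1 because \<open>v\<close> is non-zero.\<close>

lemma power_fixes_vector_iff:
  assumes "v \<noteq> 0" and nc: "central A \<or> A *v v \<notin> vec.span {v}"
  shows "((*v) A ^^ j) v = v \<longleftrightarrow> matrix_order A dvd j"
proof
  assume "matrix_order A dvd j"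
  then show "((*v) A ^^ j) v = v"
    using matrix_power_eq_1_iff_dvd[of j] by (simp add: matrix_power_eq_1_iff)
next
  assume fx: "((*v) A ^^ j) v = v"
  then have "((*v) A ^^ j) v \<in> vec.span {v}" using mem_span_self by simp
  then have "central (matrix_power A j)"
    using power_stabilizes_line_iff[OF assms] central_power_iff_dvd by simp
  then obtain c where c: "\<And>x. ((*v) A ^^ j) x = c *s x" unfolding central_matrix_power_iff by blast
  have "c *s v = 1 *s v" using fx c[of v] by simp
  then have "c = 1" using assms(1) by (simp only: vector_mul_rcancel) simp
  then have "(*v) A ^^ j = id" using c by (simp add: fun_eq_iff)
  then show "matrix_order A dvd j"
    using matrix_power_eq_1_iff_dvd matrix_power_eq_1_iff by blast
qed

lemma image_span_single: "(*v) A ` vec.span {v} = vec.span {A *v v}"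
  unfolding vec.span_singleton by (auto simp: vector_scalar_commute image_iff)

lemma image_line: "L \<in> lines \<Longrightarrow> (*v) A ` L \<in> lines"
  unfolding lines_iff using image_span_single matrix_vec_eq_0_iff by metis

lemma inj_image_matrix: "inj (image ((*v) A))"
  using inj_matrix by (simp add: inj_image_eq_iff inj_def)

lemma power_image_line_iff:
  assumes L: "L \<in> lines" and nc: "central A \<or> \<not> (*v) A ` L \<subseteq> L"
  shows "(image ((*v) A) ^^ j) L = L \<longleftrightarrow> central_indicator A dvd j"
proof -
  obtain v where v: "v \<noteq> 0" "L = vec.span {v}" using L lines_iff by blast
  have img: "((*v) A ^^ j) ` L = vec.span {((*v) A ^^ j) v}"
    unfolding v(2) vec.span_singleton by (auto simp: funpow_matrix_smult image_iff)
  have "(*v) A ` L \<subseteq> L" if "A *v v \<in> vec.span {v}"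
    unfolding v(2) image_span_single using that by (simp add: vec.span_minimal vec.subspace_span)
  then have nc': "central A \<or> A *v v \<notin> vec.span {v}" using nc by blast
  have nz: "((*v) A ^^ j) v \<noteq> 0"
  proof (induction j)
    case (Suc j) then show ?case by (simp add: matrix_vec_eq_0_iff)
  qed (simp add: v(1))
  have "(image ((*v) A) ^^ j) L = L \<longleftrightarrow> vec.span {((*v) A ^^ j) v} = vec.span {v}"
    by (simp add: image_funpow img v(2)[symmetric])
  also have "\<dots> \<longleftrightarrow> ((*v) A ^^ j) v \<in> vec.span {v}"
    using lines_eq_span[OF span_single_in_lines[OF v(1)] _ nz] mem_span_self by blast
  also have "\<dots> \<longleftrightarrow> central_indicator A dvd j" by (rule power_stabilizes_line_iff[OF v(1) nc'])
  finally show ?thesis .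
qed

end

section \<open>Eigenlines\<close>

lemma stable_line_eigenvalue:
  assumes L: "L \<in> lines" "(*v) A ` L \<subseteq> L"
  shows "\<exists>c. \<forall>v\<in>L. A *v v = c *s v"
proof -
  obtain u where u: "u \<noteq> 0" "L = vec.span {u}" using L(1) lines_iff by blast
  then have "A *v u \<in> vec.span {u}" using L(2) mem_span_self by blast
  then obtain c where c: "A *v u = c *s u" using mem_span_single_iff by blast
  have "A *v v = c *s v" if "v \<in> L" for v
  proof -
    obtain b where "v = b *s u" using \<open>v \<in> L\<close> u(2) mem_span_single_iff by blast
    then show ?thesis using c by (simp add: vector_scalar_commute vector_smult_assoc mult.commute)
  qed
  then show ?thesis by blast
qed

lemma combination_eq_0_iff:
  fixes v w :: "'a::field^2"
  assumes "v \<noteq> 0" "w \<notin> vec.span {v}"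
  shows "a *s v + b *s w = 0 \<longleftrightarrow> a = 0 \<and> b = 0"
proof
  assume eq: "a *s v + b *s w = 0"
  have "b = 0"
  proof (rule ccontr)
    assume "b \<noteq> 0"
    have "w $ i = - (inverse b * a) * v $ i" for i
    proof -
      have "a * v $ i + b * w $ i = 0" using eq by (simp add: vec_eq_iff)
      then have "b * w $ i = - (a * v $ i)" by (simp add: add_eq_0_iff)
      then have "inverse b * (b * w $ i) = inverse b * - (a * v $ i)" by simp
      then show ?thesis using \<open>b \<noteq> 0\<close> by (simp add: mult.assoc[symmetric])
    qed
    then have "w = (- (inverse b * a)) *s v" by (simp add: vec_eq_iff)
    then show False using assms(2) mem_span_single_iff by blast
  qed
  then show "a = 0 \<and> b = 0" using eq assms(1) by simp
qed simp

lemma combination_matrix: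
  "A *v (a *s v + b *s w) = a *s (A *v v) + b *s (A *v w)" for A :: "'a::field^2^2"
  by (simp add: matrix_vector_right_distrib vector_scalar_commute)

context
  fixes A :: "'a::{field,finite}^2^2"
  assumes inv: "invertible A"
begin

lemma eigenvalue_nonzero: "v \<noteq> 0 \<Longrightarrow> A *v v = c *s v \<Longrightarrow> c \<noteq> 0"
  using matrix_vec_eq_0_iff[OF inv, of v] by auto

lemma central_of_two_eigenvectors:
  assumes "v \<noteq> 0" "w \<notin> vec.span {v}" "A *v v = c *s v" "A *v w = c *s w"
  shows "central A"
proof -
  have "A *v x = c *s x" for x
  proof -
    obtain a b where "x = a *s v + b *s w" using decompose_pair[OF assms(1,2)] .
    then show ?thesis using assms(3,4)
      by (simp add: combination_matrix vector_smult_assoc vector_add_ldistrib mult.commute)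
  qed
  then show ?thesis using eigenvalue_nonzero[OF assms(1,3)] eq_mat_iff central_def by blast
qed

lemma span_eigenvector_stable:
  assumes "A *v v = c *s v"
  shows "(*v) A ` vec.span {v} \<subseteq> vec.span {v}"
  unfolding image_span_single[OF inv] assms
  by (simp add: vec.span_minimal vec.subspace_span vec.span_scale vec.span_base)

text \<open>A stable line consists of eigenvectors for one scalar. A further eigenvector for that
  scalar outside the line would force \<open>A\<close> to be scalar, so the line is a whole
  eigenspace. For a central matrix every line is stable although no eigenspace has dimension
  1.\<close>

lemma eigenlines_eq:
  assumes nc: "\<not> central A"
  shows "eigenlines A = {L \<in> lines. (*v) A ` L \<subseteq> L}"
proof (intro equalityI subsetI)
  fix E assume "E \<in> eigenlines A"
  then obtain c where c: "E = eigenspace A c" "vec.dim E = 1" by (auto simp: eigenlines_def)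
  have sub: "vec.subspace E" unfolding c(1) eigenspace_def
    by (rule vec.subspaceI) (simp_all add: matrix_vector_right_distrib vector_add_ldistrib
        vector_scalar_commute vector_smult_assoc mult.commute)
  have "(*v) A ` E \<subseteq> E"
    using c(1) by (auto simp: eigenspace_def vector_scalar_commute)
  then show "E \<in> {L \<in> lines. (*v) A ` L \<subseteq> L}" using sub c(2) by (simp add: lines_def)
next
  fix L assume "L \<in> {L \<in> lines. (*v) A ` L \<subseteq> L}"
  then have L: "L \<in> lines" "(*v) A ` L \<subseteq> L" by auto
  obtain c where c: "\<And>v. v \<in> L \<Longrightarrow> A *v v = c *s v" using stable_line_eigenvalue[OF L] by blast
  obtain u where u: "u \<noteq> 0" "L = vec.span {u}" using L(1) lines_iff by blast
  have cu: "A *v u = c *s u" using c u(2) mem_span_self by blast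
  have "eigenspace A c = L"
  proof (rule ccontr)
    assume "eigenspace A c \<noteq> L"
    then obtain w where "A *v w = c *s w" "w \<notin> vec.span {u}"
      using c u(2) by (auto simp: eigenspace_def)
    then show False using central_of_two_eigenvectors[OF u(1) _ cu] nc by blast
  qed
  then show "L \<in> eigenlines A" using L(1) unfolding eigenlines_def lines_def by auto
qed

lemma span_eigenvector_eigenline:
  assumes "\<not> central A" "v \<noteq> 0" "A *v v = c *s v"
  shows "vec.span {v} \<in> eigenlines A"
  using span_eigenvector_stable[OF assms(3)] span_single_in_lines[OF assms(2)] eigenlines_eq[OF assms(1)] by simp

text \<open>An eigenvector on a third line is a combination of eigenvectors on the first two with
  both coefficients non-zero. Comparing coefficients makes the eigenvalues equal, and then
  \<open>A\<close> is central.\<close>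

lemma card_eigenlines_le:
  assumes nc: "\<not> central A"
  shows "card (eigenlines A) \<le> 2"
proof (rule ccontr)
  assume "\<not> card (eigenlines A) \<le> 2"
  then obtain S where "S \<subseteq> eigenlines A" "card S = 3"
    using obtain_subset_with_card_n[of 3 "eigenlines A"] by auto
  then obtain K L N where KLN: "K \<in> eigenlines A" "L \<in> eigenlines A" "N \<in> eigenlines A" "K \<noteq> L" "K \<noteq> N" "L \<noteq> N"
    by (auto simp: card_3_iff)
  then have lines: "K \<in> lines" "L \<in> lines" "N \<in> lines"
    and st: "(*v) A ` K \<subseteq> K" "(*v) A ` L \<subseteq> L" "(*v) A ` N \<subseteq> N" using eigenlines_eq[OF nc] by auto
  obtain v w x where vs: "v \<in> K" "w \<in> L" "x \<in> N" "v \<noteq> 0" "w \<noteq> 0" "x \<noteq> 0" using lines lines_nonzero by metis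
  obtain a b c where ev: "A *v v = a *s v" "A *v w = b *s w" "A *v x = c *s x"
    using stable_line_eigenvalue[OF lines(1) st(1)] stable_line_eigenvalue[OF lines(2) st(2)]
      stable_line_eigenvalue[OF lines(3) st(3)] vs by blast
  have w: "w \<notin> vec.span {v}" using lines_eq_of_common lines KLN vs lines_eq_span by metis
  obtain r s where x: "x = r *s v + s *s w" using decompose_pair[OF vs(4) w] .
  have "r \<noteq> 0"
  proof
    assume "r = 0"
    then have "x \<in> vec.span {w}" using x mem_span_single_iff by auto
    then show False using lines_eq_of_common lines KLN vs lines_eq_span by metis
  qed
  have "s \<noteq> 0"
  proof
    assume "s = 0"
    then have "x \<in> vec.span {v}" using x mem_span_single_iff by auto
    then show False using lines_eq_of_common lines KLN vs lines_eq_span by metis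
  qed
  have "r *s (a *s v) + s *s (b *s w) = c *s x"
    using ev x combination_matrix by metis
  then have "(r * (a - c)) *s v + (s * (b - c)) *s w = 0"
    unfolding x by (simp add: vec_eq_iff algebra_simps)
  then have "r * (a - c) = 0" "s * (b - c) = 0"
    using combination_eq_0_iff[OF vs(4) w] by blast+
  then have "a = b" using \<open>r \<noteq> 0\<close> \<open>s \<noteq> 0\<close> by simp
  then show False using central_of_two_eigenvectors[OF vs(4) w] ev nc by blast
qed

lemma type_cases:
  obtains "central A" "\<not> elliptic A" "\<not> parabolic A" "\<not> hyperbolic A"
  | "elliptic A" "\<not> central A" "\<not> parabolic A" "\<not> hyperbolic A" "eigenlines A = {}"
  | "parabolic A" "\<not> central A" "\<not> elliptic A" "\<not> hyperbolic A" "card (eigenlines A) = 1"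
  | "hyperbolic A" "\<not> central A" "\<not> elliptic A" "\<not> parabolic A" "card (eigenlines A) = 2"
proof (cases "central A")
  case True
  then show ?thesis using that(1) by (simp add: elliptic_def parabolic_def hyperbolic_def)
next
  case False
  have fin: "finite (eigenlines A)" by simp
  consider "card (eigenlines A) = 0" | "card (eigenlines A) = 1" | "card (eigenlines A) = 2"
    using card_eigenlines_le[OF False] by linarith
  then show ?thesis
  proof cases
    case 1
    then have "eigenlines A = {}" using fin by (simp only: card_0_eq)
    then show ?thesis using that(2) False by (simp add: elliptic_def parabolic_def hyperbolic_def)
  next
    case 2 then show ?thesis using that(3) False by (simp add: elliptic_def parabolic_def hyperbolic_def)
  next
    case 3 then show ?thesis using that(4) False by (simp add: elliptic_def parabolic_def hyperbolic_def)
  qed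
qed

text \<open>\<open>eigenvalue_orders\<close> attaches the orders to eigenvalues, whereas blocks are
  made of lines; this selects the lines that carry \<open>e\<close> and \<open>f\<close>. In the
  hyperbolic case distinct eigenvalues have distinct lines, which exhaust the two eigenlines. The
  sole eigenline of a parabolic element goes to \<open>S1\<close>.\<close>

lemma eigenline_split:
  assumes ord: "eigenvalue_orders A e f"
  obtains S1 S2 where "S1 \<union> S2 = (if central A then {} else eigenlines A)" "S1 \<inter> S2 = {}"
    "card S1 = (if parabolic A \<or> hyperbolic A then 1 else 0)" "card S2 = (if hyperbolic A then 1 else 0)"
    "\<And>L. L \<in> S1 \<Longrightarrow> \<exists>a. mult_order a = e \<and> (\<forall>v\<in>L. A *v v = a *s v)"
    "\<And>L. L \<in> S2 \<Longrightarrow> \<exists>a. mult_order a = f \<and> (\<forall>v\<in>L. A *v v = a *s v)"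
proof -
  have scale: "\<forall>x \<in> vec.span {v}. A *v x = a *s x" if "A *v v = a *s v" for v a
    using that by (auto simp: mem_span_single_iff vector_scalar_commute vector_smult_assoc mult.commute)
  show ?thesis
  proof (cases rule: type_cases)
    case 1 then show ?thesis using that[of "{}" "{}"] by simp
  next
    case 2 then show ?thesis using that[of "{}" "{}"] by simp
  next
    case 3
    then obtain a where a: "eigenvalue A a" "mult_order a = e" using ord by (auto simp: eigenvalue_orders_def)
    then obtain v where v: "v \<noteq> 0" "A *v v = a *s v" by (auto simp: eigenvalue_def)
    have "vec.span {v} \<in> eigenlines A" by (rule span_eigenvector_eigenline[OF 3(2) v])
    then have "eigenlines A = {vec.span {v}}" using 3(5) by (metis card_1_singletonE singletonD)
    then show ?thesis using that[of "{vec.span {v}}" "{}"] 3 a(2) scale[OF v(2)] by auto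
  next
    case 4
    then obtain a b where ab: "a \<noteq> b" "eigenvalue A a" "eigenvalue A b" "mult_order a = e" "mult_order b = f"
      using ord by (auto simp: eigenvalue_orders_def)
    obtain v where v: "v \<noteq> 0" "A *v v = a *s v" using ab(2) by (auto simp: eigenvalue_def)
    obtain w where w: "w \<noteq> 0" "A *v w = b *s w" using ab(3) by (auto simp: eigenvalue_def)
    have in_el: "vec.span {v} \<in> eigenlines A" "vec.span {w} \<in> eigenlines A"
      by (rule span_eigenvector_eigenline[OF 4(2) v], rule span_eigenvector_eigenline[OF 4(2) w])
    have ne: "vec.span {v} \<noteq> vec.span {w}"
    proof
      assume "vec.span {v} = vec.span {w}"
      then have "A *v w = a *s w" using scale[OF v(2)] mem_span_self by metis
      then have "a *s w = b *s w" using w(2) by metis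
      then show False using ab(1) w(1) by auto
    qed
    have "{vec.span {v}, vec.span {w}} = eigenlines A"
      by (rule card_subset_eq) (use in_el ne 4(5) in auto)
    then show ?thesis
      using that[of "{vec.span {v}}" "{vec.span {w}}"] 4 ab(4,5) scale[OF v(2)] scale[OF w(2)] ne by auto
  qed
qed

end

section \<open>Multiplicative orders of eigenvalues\<close>

lemma mult_order_pos: "c \<noteq> 0 \<Longrightarrow> mult_order c > 0"
  and power_eq_1_iff_mult_order_dvd: "c \<noteq> 0 \<Longrightarrow> c ^ j = 1 \<longleftrightarrow> mult_order c dvd j"
  for c :: "'a::{field,finite}"
proof -
  assume c: "c \<noteq> 0"
  have "inj ((*) c)" using c by (simp add: inj_def)
  then obtain k where k: "k > 0" "((*) c ^^ k) = id" by (rule funpow_eq_id_finite)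
  have "((*) c ^^ j) x = c ^ j * x" for j x by (induction j) (simp_all add: mult.assoc)
  then have 1: "c ^ k = 1" using fun_cong[OF k(2), of 1] by simp
  have 3: "c ^ (m + n) = 1 \<longleftrightarrow> c ^ n = 1" if "c ^ m = 1" for m n using that by (simp add: power_add)
  show "mult_order c > 0" unfolding mult_order_def
    by (rule Least_pos_dvd_iff(1)[where P="\<lambda>k. c ^ k = 1", OF k(1) 1 power_0 3])
  show "c ^ j = 1 \<longleftrightarrow> mult_order c dvd j" unfolding mult_order_def
    by (rule Least_pos_dvd_iff(2)[where P="\<lambda>k. c ^ k = 1", OF k(1) 1 power_0 3])
qed

lemma funpow_eigenvector:
  fixes A :: "'a::field^2^2"
  assumes "A *v v = c *s v"
  shows "((*v) A ^^ j) v = c ^ j *s v"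
  by (induction j) (simp_all add: assms vector_scalar_commute vector_smult_assoc mult.commute)

lemma power_fixes_eigenvector_iff:
  fixes A :: "'a::{field,finite}^2^2"
  assumes "v \<noteq> 0" "A *v v = c *s v" "c \<noteq> 0"
  shows "((*v) A ^^ j) v = v \<longleftrightarrow> mult_order c dvd j"
proof -
  have "((*v) A ^^ j) v = v \<longleftrightarrow> c ^ j *s v = 1 *s v" using funpow_eigenvector[OF assms(2)] by simp
  also have "\<dots> \<longleftrightarrow> c ^ j = 1" using assms(1) by (simp only: vector_mul_rcancel) simp
  finally show ?thesis using power_eq_1_iff_mult_order_dvd[OF assms(3)] by simp
qed

section \<open>Spanning zero-sum multisets\<close>

lemma matrix_sum_mset: "A *v \<Sum>\<^sub># M = \<Sum>\<^sub># (image_mset ((*v) A) M)" for A :: "'a::field^2^2"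
  by (induction M) (simp_all add: matrix_vector_right_distrib)

lemma sum_mset_invariant_eq_0:
  fixes A :: "'a::field^2^2"
  assumes "\<not> eigenvalue A 1" "image_mset ((*v) A) M = M"
  shows "\<Sum>\<^sub># M = 0"
proof (rule ccontr)
  assume "\<Sum>\<^sub># M \<noteq> 0"
  moreover have "A *v \<Sum>\<^sub># M = 1 *s \<Sum>\<^sub># M" using matrix_sum_mset[of A M] assms(2) by simp
  ultimately show False using assms(1) unfolding eigenvalue_def by blast
qed

lemma mu_pos_iff: "mu M L > 0 \<longleftrightarrow> (\<exists>v\<in>#M. v \<in> L)"
proof -
  have "0 < size N \<longleftrightarrow> (\<exists>v. v \<in># N)" for N :: "('a^2) multiset" by (cases N) auto
  from this[of "filter_mset (\<lambda>v. v \<in> L) M"] show ?thesis by (auto simp: mu_def)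
qed

lemma size_partition_type: "size (partition_type M) = card {L \<in> lines. mu M L > 0}"
proof -
  have "partition_type M = image_mset (mu M) (filter_mset (\<lambda>L. mu M L > 0) (mset_set lines))"
    by (simp add: partition_type_def filter_mset_image_mset)
  then show ?thesis by (simp add: filter_mset_mset_set)
qed

lemma zero_sum_multiset_iff:
  fixes M :: "('a::{field,finite}^2) multiset"
  assumes M0: "0 \<notin># M" and sum0: "\<Sum>\<^sub># M = 0"
  shows "zero_sum_multiset M \<longleftrightarrow> size (partition_type M) \<ge> 2"
proof
  assume "zero_sum_multiset M"
  then have sp: "vec.span (set_mset M) = UNIV" by (simp add: zero_sum_multiset_def)
  have "M \<noteq> {#}"
  proof
    assume "M = {#}"
    then have "vec.span {0 :: 'a^2} = UNIV" using sp by (simp add: vec.span_singleton)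
    then show False using span_single_ne_UNIV by blast
  qed
  then obtain v where v: "v \<in># M" by (meson multiset_nonemptyE)
  then have "v \<noteq> 0" using M0 by metis
  have "\<not> set_mset M \<subseteq> vec.span {v}"
    using vec.span_minimal[OF _ vec.subspace_span, of "set_mset M" "{v}"] sp span_single_ne_UNIV by blast
  then obtain w where w: "w \<in># M" "w \<notin> vec.span {v}" by blast
  then have "w \<noteq> 0" using M0 by metis
  have "{vec.span {v}, vec.span {w}} \<subseteq> {L \<in> lines. mu M L > 0}"
    using v w \<open>v \<noteq> 0\<close> \<open>w \<noteq> 0\<close> mem_span_self span_single_in_lines mu_pos_iff by blast
  then have "card {vec.span {v}, vec.span {w}} \<le> card {L \<in> lines. mu M L > 0}"
    by (intro card_mono) auto
  moreover have "vec.span {v} \<noteq> vec.span {w}" using w(2) mem_span_self by blast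
  ultimately show "size (partition_type M) \<ge> 2" by (simp add: size_partition_type)
next
  assume "size (partition_type M) \<ge> 2"
  then have "2 \<le> card {L \<in> lines. mu M L > 0}" by (simp add: size_partition_type)
  from obtain_subset_with_card_n[OF this] obtain S where S: "S \<subseteq> {L \<in> lines. mu M L > 0}" "card S = 2"
    by blast
  obtain K L where "S = {K, L}" "K \<noteq> L" using S(2) by (meson card_2_iff)
  then have KL: "K \<in> lines" "L \<in> lines" "mu M K > 0" "mu M L > 0" "K \<noteq> L" using S(1) by blast+
  from KL(3,4) obtain v w where vw: "v \<in># M" "v \<in> K" "w \<in># M" "w \<in> L" unfolding mu_pos_iff by blast
  then have nz: "v \<noteq> 0" "w \<noteq> 0" using M0 by metis+
  have w: "w \<notin> vec.span {v}"
    using lines_eq_span[OF KL(1) vw(2) nz(1)] lines_eq_of_common[OF KL(1,2) _ vw(4) nz(2)] KL(5) by blast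
  have "vec.span {v, w} \<subseteq> vec.span (set_mset M)" using vw by (intro vec.span_mono) auto
  then have span: "vec.span (set_mset M) = UNIV" using span_pair_UNIV[OF nz(1) w] by blast
  have "v \<noteq> w" using w mem_span_self by blast
  have "w \<in># M - {#v#}" using vw(3) \<open>v \<noteq> w\<close> by (simp add: in_diff_count)
  then obtain N where "M - {#v#} = add_mset w N" by (metis mset_add)
  then have N: "M = {#v, w#} + N" using vw(1) by (metis insert_DiffM add_mset_add_single union_mset_add_mset_left add.left_neutral)
  \<comment> \<open>A third element exists because two vectors with sum 0 are opposite and would lie
    on one line.\<close>
  have "N \<noteq> {#}"
  proof
    assume "N = {#}"
    then have "v + w = 0" using sum0 N by simp
    then have "w = (-1) *s v" by (simp add: eq_neg_iff_add_eq_0 add.commute)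
    then show False using w mem_span_single_iff by blast
  qed
  then have "size M \<ge> 3" using N by (cases N) auto
  then show "zero_sum_multiset M" using M0 sum0 span by (simp add: zero_sum_multiset_def)
qed


section \<open>Blocks of lines\<close>

lemma image_eq_of_closed: "finite S \<Longrightarrow> inj g \<Longrightarrow> g ` S \<subseteq> S \<Longrightarrow> g ` S = S"
  by (simp add: endo_inj_surj inj_on_subset)

text \<open>A non-zero vector lies on exactly one line, so each element of \<open>M\<close> is
  counted in at most one summand; the vector 0, common to all lines, is excluded.\<close>

lemma size_filter_Union_lines:
  fixes M :: "('a::{field,finite}^2) multiset"
  assumes "b \<subseteq> lines" "0 \<notin># M"
  shows "size (filter_mset (\<lambda>x. x \<in> \<Union>b - {0}) M) = (\<Sum>L\<in>b. mu M L)"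
  using assms(2)
proof (induction M)
  case empty
  then show ?case by (simp add: mu_def)
next
  case (add x M)
  have fin: "finite b" by simp
  have x: "x \<noteq> 0" using add.prems by auto
  have IH: "size (filter_mset (\<lambda>x. x \<in> \<Union>b - {0}) M) = (\<Sum>L\<in>b. mu M L)"
    by (rule add.IH) (use add.prems in auto)
  have "(\<Sum>L\<in>b. mu (add_mset x M) L) = (\<Sum>L\<in>b. mu M L + (if x \<in> L then 1 else 0))"
    by (rule sum.cong) (simp_all add: mu_def)
  also have "\<dots> = (\<Sum>L\<in>b. mu M L) + (\<Sum>L\<in>b. if x \<in> L then 1 else 0)" by (rule sum.distrib)
  also have "(\<Sum>L\<in>b. if x \<in> L then 1 else 0 :: nat) = (if x \<in> \<Union>b - {0} then 1 else 0)"
  proof (cases "x \<in> \<Union>b")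
    case True
    then obtain K where K: "K \<in> b" "x \<in> K" by blast
    have "x \<in> L \<longleftrightarrow> L = K" if "L \<in> b" for L
      using lines_eq_of_common[of L K x] that K x assms(1) by blast
    then have "(\<Sum>L\<in>b. if x \<in> L then 1 else 0 :: nat) = (\<Sum>L\<in>b. if L = K then 1 else 0)"
      by (intro sum.cong) auto
    then show ?thesis using True x K fin by simp
  next
    case False
    then have "(\<Sum>L\<in>b. if x \<in> L then 1 else 0 :: nat) = (\<Sum>L\<in>b. 0)"
      by (intro sum.cong) auto
    then show ?thesis using False by simp
  qed
  finally show ?case using IH by simp
qed

text \<open>Source of the d'-fold repetition of parts: lines in one orbit carry the same
  multiplicity.\<close>

lemma mu_image:
  assumes "inj ((*v) A)" "image_mset ((*v) A) M = M"
  shows "mu M ((*v) A ` L) = mu M L"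
proof -
  have "filter_mset (\<lambda>v. v \<in> (*v) A ` L) (image_mset ((*v) A) M) = image_mset ((*v) A) (filter_mset (\<lambda>v. v \<in> L) M)"
    by (simp add: filter_mset_image_mset inj_image_mem_iff[OF assms(1)])
  then show ?thesis unfolding mu_def assms(2) by simp
qed

text \<open>
  \<open>S1\<close> and \<open>S2\<close> contain the eigenline, if there is one, whose eigenvalue has order \<open>e\<close> and \<open>f\<close>. A
  block is an orbit of lines, as a set of lines: a singleton in \<open>I1\<close> or \<open>I2\<close> for an eigenline, and
  \<open>d'\<close> lines in \<open>I0\<close>. All lines are in \<open>I0\<close> blocks if the matrix is central or elliptic.
\<close>
locale line_blocks =
  fixes A :: "'a::{field,finite}^2^2" and e f :: nat and S1 S2 :: "('a^2) set set"
  assumes prime_card: "prime CARD('a)" and inv: "invertible A" and no1: "\<not> eigenvalue A 1"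
    and S_Un: "S1 \<union> S2 = (if central A then {} else eigenlines A)" and S_Int: "S1 \<inter> S2 = {}"
    and card_S1: "card S1 = (if parabolic A \<or> hyperbolic A then 1 else 0)"
    and card_S2: "card S2 = (if hyperbolic A then 1 else 0)"
    and S1_order: "\<And>L. L \<in> S1 \<Longrightarrow> \<exists>a. mult_order a = e \<and> (\<forall>v\<in>L. A *v v = a *s v)"
    and S2_order: "\<And>L. L \<in> S2 \<Longrightarrow> \<exists>a. mult_order a = f \<and> (\<forall>v\<in>L. A *v v = a *s v)"
begin

abbreviation "T \<equiv> (*v) A"

definition S0 where "S0 = lines - (S1 \<union> S2)"
definition I0 where "I0 = orbit (image T) ` S0"
definition I1 where "I1 = (\<lambda>L. {L}) ` S1"
definition I2 where "I2 = (\<lambda>L. {L}) ` S2"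
definition U where "U b = \<Union>b - {0 :: 'a^2}"
text \<open>A vector orbit in the block \<open>b\<close> puts \<open>quot b\<close> vectors on each
  line of the block and has \<open>period b\<close> elements in all.\<close>

definition quot where "quot b = (if b \<in> I1 then e else if b \<in> I2 then f else central_quotient A)"
definition period where "period b = (if b \<in> I1 then e else if b \<in> I2 then f else matrix_order A)"

lemma inj_T: "inj T" by (rule inj_matrix[OF inv])
lemma perm_T: "permutation T" by (rule permutation_finite[OF bij_matrix[OF inv]])
lemma inj_F: "inj (image T)" by (rule inj_image_matrix[OF inv])
lemma perm_F: "permutation (image T)"
  using inj_F by (intro permutation_finite) (simp add: finite_UNIV_inj_surj bij_def)

text \<open>For a central matrix every line is stable, yet it is treated as having no eigenlines;
  the second alternative keeps that case apart.\<close>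

lemma S_stable: "S1 \<union> S2 = {L \<in> lines. T ` L \<subseteq> L} \<or> central A \<and> S1 \<union> S2 = {}"
  using S_Un eigenlines_eq[OF inv] by auto

lemma S_lines: "S1 \<subseteq> lines" "S2 \<subseteq> lines" "S0 \<subseteq> lines"
  using S_stable by (auto simp: S0_def)

lemma S_fixed: "L \<in> S1 \<union> S2 \<Longrightarrow> T ` L = L"
  using S_stable image_eq_of_closed[OF _ inj_T, of L] by auto

lemma S0_not_stable: "L \<in> S0 \<Longrightarrow> central A \<or> \<not> T ` L \<subseteq> L"
  using S_stable by (auto simp: S0_def)

text \<open>An eigenline is its own image and the action on lines is injective, so no other line is
  mapped onto it.\<close>

lemma S0_closed: "image T ` S0 \<subseteq> S0"
proof
  fix K assume "K \<in> image T ` S0"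
  then obtain L where L: "L \<in> S0" "K = T ` L" by blast
  have K: "K \<in> lines" using L image_line[OF inv] by (auto simp: S0_def)
  have "K \<notin> S1 \<union> S2"
  proof
    assume K12: "K \<in> S1 \<union> S2"
    have "T ` K = T ` L" by (rule trans[OF S_fixed[OF K12] L(2)])
    then have "K = L" by (rule injD[OF inj_F])
    then show False using K12 L(1) by (simp add: S0_def)
  qed
  then show "K \<in> S0" using K by (simp add: S0_def)
qed

lemma card_orbit_S0:
  assumes L: "L \<in> S0"
  shows "card (orbit (image T) L) = central_indicator A"
proof (rule card_orbit_eq_period[OF inj_F central_indicator_pos[OF inv]])
  have "L \<in> lines" using L S_lines by blast
  then show "((image T) ^^ j) L = L \<longleftrightarrow> central_indicator A dvd j" for j
    by (rule power_image_line_iff[OF inv _ S0_not_stable[OF L]])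
qed

lemma I0_subset: "b \<in> I0 \<Longrightarrow> b \<subseteq> S0"
  using orbit_closed_subset[OF S0_closed] by (auto simp: I0_def)

lemma I_disjoint: "I1 \<inter> I2 = {}" "I1 \<inter> I0 = {}" "I2 \<inter> I0 = {}"
proof -
  show "I1 \<inter> I2 = {}" using S_Int by (auto simp: I1_def I2_def)
  show "I1 \<inter> I0 = {}" "I2 \<inter> I0 = {}" using I0_subset by (auto simp: I1_def I2_def S0_def)
qed

lemma block_lines: "b \<in> I1 \<union> I2 \<union> I0 \<Longrightarrow> b \<subseteq> lines"
  using I0_subset[of b] S_lines by (auto simp: I1_def I2_def dest: subsetD)

lemma blocks_disjoint:
  assumes "b \<in> I1 \<union> I2 \<union> I0" "c \<in> I1 \<union> I2 \<union> I0" "b \<noteq> c"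
  shows "b \<inter> c = {}"
proof -
  have 0: "b \<inter> c = {}" if "b \<in> I0" "c \<in> I0" "b \<noteq> c" for b c
    using orbits_disjoint[OF perm_F] that by (simp add: I0_def)
  have 1: "b \<inter> c = {}" "c \<inter> b = {}" if "b \<in> I1 \<union> I2" "c \<in> I0" for b c
    using I0_subset[OF that(2)] that(1) by (auto simp: I1_def I2_def S0_def)
  have 2: "b \<inter> c = {}" if "b \<in> I1 \<union> I2" "c \<in> I1 \<union> I2" "b \<noteq> c" for b c
    using that by (auto simp: I1_def I2_def)
  have mem: "b \<in> I0 \<or> b \<in> I1 \<union> I2" "c \<in> I0 \<or> c \<in> I1 \<union> I2" using assms(1,2) by blast+
  from mem(1) show ?thesis
  proof
    assume b: "b \<in> I0"
    from mem(2) show ?thesis by (rule disjE) (rule 0[OF b _ assms(3)], assumption, rule 1(2)[OF _ b])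
  next
    assume b: "b \<in> I1 \<union> I2"
    from mem(2) show ?thesis by (rule disjE) (rule 1(1)[OF b], assumption, rule 2[OF b _ assms(3)])
  qed
qed

lemma U_disjoint: "disjoint_family_on U (I1 \<union> I2 \<union> I0)"
  unfolding disjoint_family_on_def
proof (intro ballI impI)
  fix b c assume bc: "b \<in> I1 \<union> I2 \<union> I0" "c \<in> I1 \<union> I2 \<union> I0" "b \<noteq> c"
  show "U b \<inter> U c = {}"
  proof (rule ccontr)
    assume "U b \<inter> U c \<noteq> {}"
    then obtain v K L where "v \<noteq> 0" "v \<in> K" "v \<in> L" "K \<in> b" "L \<in> c" by (auto simp: U_def)
    then have "K = L" using lines_eq_of_common[of K L v] block_lines[OF bc(1)] block_lines[OF bc(2)] by blast
    then show False using blocks_disjoint[OF bc] \<open>K \<in> b\<close> \<open>L \<in> c\<close> by blast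
  qed
qed

lemma block_closed: "b \<in> I1 \<union> I2 \<union> I0 \<Longrightarrow> L \<in> b \<Longrightarrow> T ` L \<in> b"
  using S_fixed by (auto simp: I1_def I2_def I0_def intro: orbit.step)

lemma U_closed:
  assumes "b \<in> I1 \<union> I2 \<union> I0"
  shows "T x \<in> U b \<longleftrightarrow> x \<in> U b"
proof (rule mem_iff_of_closed[OF inj_T])
  show "T ` U b \<subseteq> U b"
  proof
    fix y assume "y \<in> T ` U b"
    then obtain x L where x: "y = T x" "x \<noteq> 0" "x \<in> L" "L \<in> b" by (auto simp: U_def)
    then have "T x \<in> T ` L" "T ` L \<in> b" using block_closed[OF assms] by auto
    moreover have "T x \<noteq> 0" using x(2) matrix_vec_eq_0_iff[OF inv] by simp
    ultimately show "y \<in> U b" using x(1) by (auto simp: U_def)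
  qed
qed simp

section \<open>Orbit sizes and block sizes\<close>

lemma S1_period:
  assumes "L \<in> S1" "v \<in> L" "v \<noteq> 0"
  shows "card (orbit T v) = e" "e > 0"
proof -
  obtain a where a: "mult_order a = e" "A *v v = a *s v" using S1_order[OF assms(1)] assms(2) by blast
  have a0: "a \<noteq> 0" by (rule eigenvalue_nonzero[OF inv assms(3) a(2)])
  show "e > 0" using mult_order_pos[OF a0] a(1) by simp
  then show "card (orbit T v) = e"
    using power_fixes_eigenvector_iff[OF assms(3) a(2) a0] a(1) by (intro card_orbit_eq_period[OF inj_T]) auto
qed

lemma S2_period:
  assumes "L \<in> S2" "v \<in> L" "v \<noteq> 0"
  shows "card (orbit T v) = f" "f > 0"
proof -
  obtain a where a: "mult_order a = f" "A *v v = a *s v" using S2_order[OF assms(1)] assms(2) by blast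
  have a0: "a \<noteq> 0" by (rule eigenvalue_nonzero[OF inv assms(3) a(2)])
  show "f > 0" using mult_order_pos[OF a0] a(1) by simp
  then show "card (orbit T v) = f"
    using power_fixes_eigenvector_iff[OF assms(3) a(2) a0] a(1) by (intro card_orbit_eq_period[OF inj_T]) auto
qed

lemma S0_period:
  assumes "L \<in> S0" "v \<in> L" "v \<noteq> 0"
  shows "card (orbit T v) = matrix_order A"
proof -
  have L: "L = vec.span {v}" using lines_eq_span assms S_lines by blast
  have "central A \<or> A *v v \<notin> vec.span {v}"
  proof -
    have "T ` L \<subseteq> L" if "A *v v \<in> vec.span {v}"
      unfolding L image_span_single[OF inv] using that by (simp add: vec.span_minimal vec.subspace_span)
    then show ?thesis using S0_not_stable[OF assms(1)] by blast
  qed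
  from power_fixes_vector_iff[OF inv assms(3) this] show ?thesis
    by (intro card_orbit_eq_period[OF inj_T matrix_order_pos[OF inv]])
qed

lemma not_I0: "b \<in> I0 \<Longrightarrow> b \<notin> I1 \<and> b \<notin> I2" and not_I2: "b \<in> I2 \<Longrightarrow> b \<notin> I1"
  using I_disjoint by auto

lemma orbit_period:
  assumes "b \<in> I1 \<union> I2 \<union> I0" "x \<in> U b"
  shows "card (orbit T x) = period b"
proof -
  obtain L where L: "L \<in> b" "x \<in> L" "x \<noteq> 0" using assms(2) by (auto simp: U_def)
  consider "b \<in> I1" | "b \<in> I2" | "b \<in> I0" using assms(1) by blast
  then show ?thesis
  proof cases
    case 1
    then have "L \<in> S1" using L(1) by (auto simp: I1_def)
    from S1_period(1)[OF this L(2,3)] 1 show ?thesis by (simp add: period_def)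
  next
    case 2
    then have "L \<in> S2" using L(1) by (auto simp: I2_def)
    from S2_period(1)[OF this L(2,3)] 2 not_I2[OF 2] show ?thesis by (simp add: period_def)
  next
    case 3
    then have "L \<in> S0" using L(1) I0_subset by blast
    from S0_period[OF this L(2,3)] not_I0[OF 3] show ?thesis by (simp add: period_def)
  qed
qed

text \<open>When no eigenline carries them, \<open>e\<close> and \<open>f\<close> may be arbitrary,
  even 0; hence the guards.\<close>

lemma e_pos: "S1 \<noteq> {} \<Longrightarrow> e > 0" and f_pos: "S2 \<noteq> {} \<Longrightarrow> f > 0"
proof -
  show "e > 0" if "S1 \<noteq> {}"
    using that S_lines lines_nonzero S1_period(2) by (metis ex_in_conv subsetD)
  show "f > 0" if "S2 \<noteq> {}"
    using that S_lines lines_nonzero S2_period(2) by (metis ex_in_conv subsetD)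
qed

lemma period_pos: "b \<in> I1 \<union> I2 \<union> I0 \<Longrightarrow> period b > 0"
  using e_pos f_pos matrix_order_pos[OF inv] by (auto simp: period_def I1_def I2_def)

lemma card_block:
  assumes "b \<in> I1 \<union> I2 \<union> I0"
  shows "card b > 0" "period b = card b * quot b"
proof -
  have "card b = (if b \<in> I0 then central_indicator A else 1)"
    using assms card_orbit_S0 not_I0 by (auto simp: I0_def I1_def I2_def)
  then show "card b > 0" "period b = card b * quot b"
    using central_indicator_pos[OF inv] assms not_I0 order_eq_indicator_mult_quotient[OF inv]
    by (auto simp: period_def quot_def)
qed

text \<open>Counting the vectors of the block by lines and by vector orbits, then cancelling
  \<open>card b\<close>, shows that \<open>quot b\<close> divides p - 1. The quotient is thus the
  true number of vector orbits in the block.\<close>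

lemma card_U:
  assumes b: "b \<in> I1 \<union> I2 \<union> I0"
  shows "card (U b) = period b * ((CARD('a) - 1) div quot b)"
proof -
  have c: "card (U b) = card b * (CARD('a) - 1)" unfolding U_def by (rule card_Union_lines[OF block_lines[OF b]])
  have "period b * card (orbit T ` U b) = card (U b)"
    by (rule card_eq_card_orbits_mult[OF perm_T]) (use U_closed[OF b] orbit_period[OF b] in auto)
  then have "card b * (quot b * card (orbit T ` U b)) = card b * (CARD('a) - 1)"
    using c card_block(2)[OF b] by (simp add: mult.assoc)
  then have "quot b * card (orbit T ` U b) = CARD('a) - 1" using card_block(1)[OF b] by auto
  then have "quot b * ((CARD('a) - 1) div quot b) = CARD('a) - 1" by (metis dvd_triv_left dvd_mult_div_cancel)
  then show ?thesis using c card_block(2)[OF b] by (simp add: mult.assoc)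
qed

lemma Union_I0: "\<Union>I0 = S0"
  unfolding I0_def by (rule Union_orbits[OF perm_F S0_closed])

lemma lines_split: "lines = S1 \<union> S2 \<union> S0" "S1 \<inter> S2 = {}" "S1 \<inter> S0 = {}" "S2 \<inter> S0 = {}"
  using S_lines S_Int by (auto simp: S0_def)

lemma Union_U: "(\<Union>b\<in>I1 \<union> I2 \<union> I0. U b) = UNIV - {0}"
proof -
  have "\<Union>(I1 \<union> I2 \<union> I0) = lines"
    using Union_I0 lines_split(1) by (auto simp: I1_def I2_def)
  moreover have "(\<Union>b\<in>I. U b) = \<Union>(\<Union>I) - {0}" for I by (auto simp: U_def)
  ultimately have "(\<Union>b\<in>I1 \<union> I2 \<union> I0. U b) = \<Union>lines - {0}" by metis
  then show ?thesis by (simp add: Union_lines)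
qed

text \<open>The p + 1 lines without the eigenlines fall into blocks of d' lines. Central and
  elliptic elements leave p + 1 lines, parabolic ones p and hyperbolic ones p - 1.\<close>

lemma card_I0: "card I0 = orbit_number A"
proof -
  let ?d = "central_indicator A"
  have "?d * card I0 = card S0"
    unfolding I0_def by (rule card_eq_card_orbits_mult[OF perm_F S0_closed _ card_orbit_S0]) auto
  moreover have "card S0 + card S1 + card S2 = CARD('a) + 1"
  proof -
    have "CARD('a) + 1 = card (S1 \<union> S2 \<union> S0)"
      unfolding lines_split(1)[symmetric] by (simp add: card_lines)
    also have "\<dots> = card (S1 \<union> S2) + card S0"
      by (rule card_Un_disjoint) (use lines_split in auto)
    also have "card (S1 \<union> S2) = card S1 + card S2"
      by (rule card_Un_disjoint) (use lines_split in auto)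
    finally show ?thesis by simp
  qed
  ultimately have eq: "?d * card I0 + card S1 + card S2 = CARD('a) + 1" by simp
  have d: "?d > 0" by (rule central_indicator_pos[OF inv])
  have div: "card I0 = m div ?d" if "?d * card I0 = m" for m using that d by auto
  show ?thesis
  proof (cases rule: type_cases[OF inv, case_names central elliptic parabolic hyperbolic])
    case central
    then have "?d * card I0 = CARD('a) + 1" using eq card_S1 card_S2 by presburger
    from div[OF this] show ?thesis using central by (simp add: orbit_number_def)
  next
    case elliptic
    then have "?d * card I0 = CARD('a) + 1" using eq card_S1 card_S2 by presburger
    from div[OF this] show ?thesis using elliptic by (simp add: orbit_number_def)
  next
    case parabolic
    then have "?d * card I0 = CARD('a)" using eq card_S1 card_S2 by presburger
    \<comment> \<open>Primality of p enters here: d' divides p and is not 1, so d' = p and there is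
      a single block.\<close>
    moreover have "?d \<noteq> 1" using parabolic central_iff_indicator[OF inv] by simp
    ultimately have "card I0 = 1"
      using prime_card by (metis prime_product mult.commute)
    then show ?thesis using parabolic by (simp add: orbit_number_def)
  next
    case hyperbolic
    then have "?d * card I0 = CARD('a) - 1" using eq card_S1 card_S2 by presburger
    from div[OF this] show ?thesis using hyperbolic by (simp add: orbit_number_def)
  qed
qed

end

section \<open>Reading off the expression\<close>

lemma image_mset_Union_blocks:
  assumes "finite I" and "\<And>b. b \<in> I \<Longrightarrow> finite b" and "\<And>b. b \<in> I \<Longrightarrow> card b = d"
    and "\<And>b c. b \<in> I \<Longrightarrow> c \<in> I \<Longrightarrow> b \<noteq> c \<Longrightarrow> b \<inter> c = {}"
    and "\<And>b x. b \<in> I \<Longrightarrow> x \<in> b \<Longrightarrow> g x = h b"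
  shows "image_mset g (mset_set (\<Union>I)) = repeat_mset d (image_mset h (mset_set I))"
  using assms
proof (induction I rule: finite_induct)
  case (insert b I)
  have "b \<inter> c = {}" if "c \<in> I" for c using insert.prems(3)[of b c] insert.hyps(2) that by auto
  then have disj: "b \<inter> \<Union>I = {}" by blast
  have fin: "finite b" "finite (\<Union>I)" using insert.prems(1) insert.hyps(1) by auto
  have "image_mset g (mset_set b) = image_mset (\<lambda>_. h b) (mset_set b)"
    by (rule image_mset_cong) (use insert.prems(4) fin in auto)
  also have "\<dots> = replicate_mset d (h b)"
    using insert.prems(2)[of b] by (simp add: image_mset_const_eq)
  finally have b: "image_mset g (mset_set b) = replicate_mset d (h b)" .
  have "image_mset g (mset_set (\<Union>I)) = repeat_mset d (image_mset h (mset_set I))"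
    by (rule insert.IH) (use insert.prems in auto)
  then show ?case
    using b insert.hyps by (simp add: mset_set_Union[OF fin disj])
qed simp

lemma filter_repeat_mset: "filter_mset P (repeat_mset d N) = repeat_mset d (filter_mset P N)"
  by (rule multiset_eqI) simp

lemma mem_repeat_mset: "d > 0 \<Longrightarrow> x \<in># repeat_mset d N \<longleftrightarrow> x \<in># N"
  by (simp flip: count_greater_zero_iff)

lemma filter_pos_image_mult:
  "c > 0 \<Longrightarrow> filter_mset (\<lambda>k. k > 0) (image_mset (\<lambda>q. q * c) N) = image_mset (\<lambda>q. q * c) (filter_mset (\<lambda>k. k > 0) N)"
  for c :: nat
  by (simp add: filter_mset_image_mset)

lemma mem_le_sum_mset: "x \<in># N \<Longrightarrow> x \<le> \<Sum>\<^sub># N" for x :: nat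
  by (induction N) auto

context line_blocks
begin

text \<open>The number, with multiplicity, of vector orbits that \<open>M\<close> uses in the block;
  the division is exact for invariant multisets.\<close>

definition tile where "tile M b = size (filter_mset (\<lambda>x. x \<in> U b) M) div period b"

text \<open>Each sum ranges over at most one block and yields the default 0 when the eigenline is
  missing. The filter removes the zeros coming from untiled blocks.\<close>

definition expression where
  "expression M = (\<Sum>b\<in>I1. tile M b, \<Sum>b\<in>I2. tile M b,
     filter_mset (\<lambda>k. k > 0) (image_mset (tile M) (mset_set I0)))"

definition Inv where "Inv = invariant_multisets T (UNIV - {0})"

lemma InvD: "M \<in> Inv \<Longrightarrow> image_mset T M = M" "M \<in> Inv \<Longrightarrow> 0 \<notin># M"
  by (auto simp: Inv_def invariant_multisets_def)

lemma mu_const_block: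
  assumes M: "M \<in> Inv" and b: "b \<in> I1 \<union> I2 \<union> I0" and "K \<in> b" "L \<in> b"
  shows "mu M K = mu M L"
proof (cases "b \<in> I0")
  case True
  then obtain N where N: "b = orbit (image T) N" by (auto simp: I0_def)
  have "mu M K = mu M N" if "K \<in> orbit (image T) N" for K
    using that by induction (simp_all add: mu_image[OF inj_T InvD(1)[OF M]])
  then show ?thesis using assms(3,4) N by metis
next
  case False
  then show ?thesis using b assms(3,4) by (auto simp: I1_def I2_def)
qed

lemma size_block_eq_mu:
  assumes M: "M \<in> Inv" and b: "b \<in> I1 \<union> I2 \<union> I0" and L: "L \<in> b"
  shows "size (filter_mset (\<lambda>x. x \<in> U b) M) = card b * mu M L"
proof -
  have "size (filter_mset (\<lambda>x. x \<in> U b) M) = (\<Sum>K\<in>b. mu M K)"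
    unfolding U_def by (rule size_filter_Union_lines[OF block_lines[OF b] InvD(2)[OF M]])
  also have "\<dots> = (\<Sum>K\<in>b. mu M L)" by (rule sum.cong) (use mu_const_block[OF M b _ L] in auto)
  finally show ?thesis by simp
qed

lemma size_block_eq_tile:
  assumes M: "M \<in> Inv" and b: "b \<in> I1 \<union> I2 \<union> I0"
  shows "size (filter_mset (\<lambda>x. x \<in> U b) M) = tile M b * period b"
proof -
  have "period b dvd size (filter_mset (\<lambda>x. x \<in> U b) M)"
  proof (rule dvd_size_invariant[OF perm_T _ _ orbit_period[OF b]])
    show "T ` U b \<subseteq> U b" using U_closed[OF b] by auto
    show "filter_mset (\<lambda>x. x \<in> U b) M \<in> invariant_multisets T (U b)"
      by (rule filter_mem_invariant[OF bij_matrix[OF inv] U_closed[OF b] InvD(1)[OF M]])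
  qed auto
  then show ?thesis by (simp add: tile_def)
qed

text \<open>Compare after multiplying by the number of lines in the block: these lines carry equally
  many vectors, and the block contains \<open>tile M b * period b\<close> of them.\<close>

lemma mu_eq_tile:
  assumes M: "M \<in> Inv" and b: "b \<in> I1 \<union> I2 \<union> I0" and L: "L \<in> b"
  shows "mu M L = tile M b * quot b"
proof -
  have "card b * mu M L = card b * (tile M b * quot b)"
    using size_block_eq_mu[OF assms] size_block_eq_tile[OF M b] card_block(2)[OF b]
    by (metis mult.left_commute)
  then show ?thesis using card_block(1)[OF b] by (metis mult_left_cancel less_irrefl)
qed

lemma S1_cases: "S1 = {} \<or> (\<exists>L. S1 = {L})" and S2_cases: "S2 = {} \<or> (\<exists>L. S2 = {L})"
proof -
  show "S1 = {} \<or> (\<exists>L. S1 = {L})"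
    using card_S1 by (cases "parabolic A \<or> hyperbolic A") (auto simp: card_1_singleton_iff)
  show "S2 = {} \<or> (\<exists>L. S2 = {L})"
    using card_S2 by (cases "hyperbolic A") (auto simp: card_1_singleton_iff)
qed

lemma I1_empty: "S1 = {} \<Longrightarrow> I1 = {}" and I2_empty: "S2 = {} \<Longrightarrow> I2 = {}"
  unfolding I1_def I2_def by simp_all

lemma I1_cases: "I1 = {} \<and> S1 = {} \<or> (\<exists>b. I1 = {b})" and I2_cases: "I2 = {} \<and> S2 = {} \<or> (\<exists>b. I2 = {b})"
  unfolding I1_def I2_def using S1_cases S2_cases by auto

lemma partition_S1:
  assumes M: "M \<in> Inv"
  shows "filter_mset (\<lambda>k. k > 0) (image_mset (mu M) (mset_set S1)) =
    filter_mset (\<lambda>k. k > 0) {# (\<Sum>b\<in>I1. tile M b) * e #}"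
proof (cases "S1 = {}")
  case True
  show ?thesis unfolding I1_empty[OF True] by (simp add: True)
next
  case False
  then obtain L where L: "S1 = {L}" using S1_cases by blast
  then have I1: "I1 = {{L}}" unfolding I1_def by simp
  have "mu M L = tile M {L} * quot {L}" by (rule mu_eq_tile[OF M]) (simp_all add: I1)
  then have "mu M L = (\<Sum>b\<in>I1. tile M b) * e" using I1 by (simp add: quot_def)
  then show ?thesis by (simp add: L)
qed

lemma partition_S2:
  assumes M: "M \<in> Inv"
  shows "filter_mset (\<lambda>k. k > 0) (image_mset (mu M) (mset_set S2)) =
    filter_mset (\<lambda>k. k > 0) {# (\<Sum>b\<in>I2. tile M b) * f #}"
proof (cases "S2 = {}")
  case True
  show ?thesis unfolding I2_empty[OF True] by (simp add: True)
next
  case False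
  then obtain L where L: "S2 = {L}" using S2_cases by blast
  then have I2: "I2 = {{L}}" unfolding I2_def by simp
  have "mu M L = tile M {L} * quot {L}" by (rule mu_eq_tile[OF M]) (simp_all add: I2)
  moreover have "quot {L} = f" using not_I2[of "{L}"] I2 by (simp add: quot_def)
  ultimately have "mu M L = (\<Sum>b\<in>I2. tile M b) * f" using I2 by simp
  then show ?thesis by (simp add: L)
qed

lemma partition_S0:
  assumes M: "M \<in> Inv"
  shows "filter_mset (\<lambda>k. k > 0) (image_mset (mu M) (mset_set S0)) =
    repeat_mset (central_indicator A) (image_mset (\<lambda>q. q * central_quotient A)
      (filter_mset (\<lambda>k. k > 0) (image_mset (tile M) (mset_set I0))))"
proof -
  have "image_mset (mu M) (mset_set (\<Union>I0)) =
      repeat_mset (central_indicator A) (image_mset (\<lambda>b. tile M b * central_quotient A) (mset_set I0))"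
  proof (rule image_mset_Union_blocks)
    show "card b = central_indicator A" if "b \<in> I0" for b
      using that card_orbit_S0 by (auto simp: I0_def)
    show "b \<inter> c = {}" if "b \<in> I0" "c \<in> I0" "b \<noteq> c" for b c
      using blocks_disjoint that by blast
    show "mu M L = tile M b * central_quotient A" if "b \<in> I0" "L \<in> b" for b L
      using mu_eq_tile[OF M _ that(2)] that(1) not_I0[OF that(1)] by (simp add: quot_def)
  qed auto
  also have "image_mset (\<lambda>b. tile M b * central_quotient A) (mset_set I0) =
      image_mset (\<lambda>q. q * central_quotient A) (image_mset (tile M) (mset_set I0))"
    by (simp add: multiset.map_comp comp_def)
  finally show ?thesis
    by (simp only: Union_I0 filter_repeat_mset filter_pos_image_mult[OF central_quotient_pos[OF inv]])
qed

text \<open>Eigenlines and remaining lines contribute separately, which gives every invariant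
  multiset a canonical expression of its type.\<close>

lemma partition_type_eq:
  assumes M: "M \<in> Inv"
  shows "partition_type M = expressed_partition A e f (expression M)"
proof -
  have "mset_set (lines :: ('a^2) set set) = mset_set (S1 \<union> S2 \<union> S0)" using lines_split(1) by metis
  also have "\<dots> = mset_set (S1 \<union> S2) + mset_set S0"
    by (rule mset_set_Union) (use lines_split in auto)
  also have "mset_set (S1 \<union> S2) = mset_set S1 + mset_set S2"
    by (rule mset_set_Union) (use lines_split in auto)
  finally have "partition_type M =
      filter_mset (\<lambda>k. k > 0) (image_mset (mu M) (mset_set S1)) +
      filter_mset (\<lambda>k. k > 0) (image_mset (mu M) (mset_set S2)) +
      filter_mset (\<lambda>k. k > 0) (image_mset (mu M) (mset_set S0))"
    by (simp add: partition_type_def)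
  then show ?thesis
    unfolding partition_S1[OF M] partition_S2[OF M] partition_S0[OF M]
    by (simp add: expressed_partition_def expression_def)
qed

section \<open>Feasibility as a condition on the number of parts\<close>

lemma size_expressed_partition:
  "size (expressed_partition A e f (l, n, Q)) =
    (if l * e > 0 then 1 else 0) + (if n * f > 0 then 1 else 0) + central_indicator A * size Q"
  by (simp add: expressed_partition_def)

text \<open>A tiled block of a non-central element already supplies d' > 1 parts, whereas for a
  central one each block supplies a single part, hence u > 1. A parabolic element has only one
  block, and its eigenline alone gives at most one part. A hyperbolic element can do without tiled
  blocks only if both eigenlines are used. The bound u \<le> o reflects the number of
  blocks.\<close>

lemma feasible_iff:
  assumes M: "M \<in> Inv"
  shows "feasible A (expression M) \<longleftrightarrow> size (partition_type M) \<ge> 2"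
proof -
  obtain l n Q where E: "expression M = (l, n, Q)" by (cases "expression M") auto
  have Q: "Q = filter_mset (\<lambda>k. k > 0) (image_mset (tile M) (mset_set I0))"
    and l: "l = (\<Sum>b\<in>I1. tile M b)" and n: "n = (\<Sum>b\<in>I2. tile M b)"
    using E by (simp_all add: expression_def)
  have Q1: "\<forall>q\<in>#Q. q \<ge> 1" unfolding Q by auto
  have "size Q \<le> size (image_mset (tile M) (mset_set I0))" unfolding Q by (rule size_filter_mset_lesseq)
  then have Qo: "size Q \<le> orbit_number A" by (simp add: card_I0)
  have l0: "l = 0" if "S1 = {}" using I1_empty[OF that] l by simp
  have n0: "n = 0" if "S2 = {}" using I2_empty[OF that] n by simp
  have sz: "size (partition_type M) =
      (if l * e > 0 then 1 else 0) + (if n * f > 0 then 1 else 0) + central_indicator A * size Q"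
    unfolding partition_type_eq[OF M] E size_expressed_partition ..
  have S1_empty: "S1 = {}" if "\<not> parabolic A" "\<not> hyperbolic A" using card_S1 that by simp
  have S2_empty: "S2 = {}" if "\<not> hyperbolic A" using card_S2 that by simp
  have d2: "central_indicator A \<ge> 2" if "\<not> central A"
    using central_indicator_pos[OF inv] central_iff_indicator[OF inv] that by linarith
  have ge2: "central_indicator A * k \<ge> 2" if "\<not> central A" "k > 0" for k
    using mult_le_mono[OF d2[OF that(1)], of 1 k] that(2) by simp
  show ?thesis
  proof (cases rule: type_cases[OF inv, case_names central elliptic parabolic hyperbolic])
    case central
    then have "l = 0" "n = 0" "central_indicator A = 1"
      using l0 n0 S1_empty S2_empty central_iff_indicator[OF inv] by auto
    then show ?thesis using E sz central Q1 Qo by (auto simp: feasible_def)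
  next
    case elliptic
    then have "l = 0" "n = 0" using l0 n0 S1_empty S2_empty by auto
    then have "size (partition_type M) \<ge> 2 \<longleftrightarrow> size Q > 0"
      using sz ge2[OF elliptic(2), of "size Q"] by (cases "size Q") auto
    then show ?thesis using E \<open>l = 0\<close> \<open>n = 0\<close> elliptic Q1 Qo by (simp add: feasible_def)
  next
    case parabolic
    then have "n = 0" using n0 S2_empty by auto
    moreover have "size Q \<le> 1" using Qo parabolic by (simp add: orbit_number_def)
    ultimately have "size (partition_type M) \<ge> 2 \<longleftrightarrow> size Q = 1"
      using sz ge2[OF parabolic(2), of "size Q"] by (cases "size Q") auto
    then show ?thesis using E \<open>n = 0\<close> parabolic Q1 Qo by (simp add: feasible_def)
  next
    case hyperbolic
    then have "S1 \<noteq> {}" "S2 \<noteq> {}" using card_S1 card_S2 by auto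
    then have ef: "e > 0" "f > 0" using e_pos f_pos by auto
    have "size (partition_type M) \<ge> 2 \<longleftrightarrow> (size Q = 0 \<longrightarrow> l > 0 \<and> n > 0)"
    proof (cases "size Q = 0")
      case True
      then show ?thesis using sz ef by simp
    next
      case False
      then have "central_indicator A * size Q \<ge> 2" using ge2[OF hyperbolic(2), of "size Q"] by blast
      then have "size (partition_type M) \<ge> 2" unfolding sz by (rule trans_le_add2)
      then show ?thesis using False by blast
    qed
    then show ?thesis using E hyperbolic Q1 Qo by (simp add: feasible_def)
  qed
qed

lemma feasible_without_eigenlines:
  assumes "feasible A (l, n, Q)"
  shows "S1 = {} \<Longrightarrow> l = 0" and "S2 = {} \<Longrightarrow> n = 0"
proof -
  show "l = 0" if "S1 = {}"
  proof -
    have "\<not> parabolic A" "\<not> hyperbolic A" using that card_S1 by (auto split: if_splits)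
    then show ?thesis using assms type_cases[OF inv] by (auto simp: feasible_def)
  qed
  show "n = 0" if "S2 = {}"
  proof -
    have "\<not> hyperbolic A" using that card_S2 by (auto split: if_splits)
    then show ?thesis using assms type_cases[OF inv] by (auto simp: feasible_def)
  qed
qed

text \<open>The fibre is rephrased as a prescription of labels, with the eigenline blocks as those
  whose label is fixed, so that the labelled count applies.\<close>

lemma card_expression_fibre:
  assumes feas: "feasible A (l, n, Q)"
  shows "finite {M \<in> Inv. expression M = (l, n, Q)}"
    and "real (card {M \<in> Inv. expression M = (l, n, Q)}) = tiling_count A e f (l, n, Q)"
proof -
  let ?p = "CARD('a) - 1"
  have Q0: "0 \<notin># Q" using feas by (fastforce simp: feasible_def)
  have Qo: "size Q \<le> card I0" using feas by (simp add: feasible_def card_I0)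
  note l0 = feasible_without_eigenlines(1)[OF feas] and n0 = feasible_without_eigenlines(2)[OF feas]
  \<comment> \<open>The sum has at most one term; if it has none, feasibility gives
    \<open>l = 0\<close> and both sides hold.\<close>
  have I1_iff: "(\<Sum>b\<in>I1. tile M b) = l \<longleftrightarrow> (\<forall>b\<in>I1. tile M b = l)" for M
    using I1_cases l0 by (elim disjE conjE exE) simp_all
  have I2_iff: "(\<Sum>b\<in>I2. tile M b) = n \<longleftrightarrow> (\<forall>b\<in>I2. tile M b = n)" for M
    using I2_cases n0 by (elim disjE conjE exE) simp_all
  let ?X = "{M \<in> invariant_multisets T (\<Union>b\<in>I1 \<union> I2 \<union> I0. U b).
      (\<forall>b\<in>I1. size (filter_mset (\<lambda>x. x \<in> U b) M) = l * period b) \<and>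
      (\<forall>b\<in>I2. size (filter_mset (\<lambda>x. x \<in> U b) M) = n * period b) \<and>
      filter_mset (\<lambda>k. k > 0)
        (image_mset (\<lambda>b. size (filter_mset (\<lambda>x. x \<in> U b) M) div period b) (mset_set I0)) = Q}"
  have sz_iff: "size (filter_mset (\<lambda>x. x \<in> U b) M) = k * period b \<longleftrightarrow> tile M b = k"
    if "M \<in> Inv" "b \<in> I1 \<union> I2 \<union> I0" for M b k
    using size_block_eq_tile[OF that] period_pos[OF that(2)] by simp
  have X_eq: "{M \<in> Inv. expression M = (l, n, Q)} = ?X"
    unfolding Union_U Inv_def[symmetric]
  proof (rule Collect_cong, rule conj_cong[OF refl])
    fix M assume M: "M \<in> Inv"
    have "(\<forall>b\<in>I1. size (filter_mset (\<lambda>x. x \<in> U b) M) = l * period b) \<longleftrightarrow> (\<Sum>b\<in>I1. tile M b) = l"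
      using sz_iff[OF M] I1_iff by simp
    moreover have "(\<forall>b\<in>I2. size (filter_mset (\<lambda>x. x \<in> U b) M) = n * period b) \<longleftrightarrow> (\<Sum>b\<in>I2. tile M b) = n"
      using sz_iff[OF M] I2_iff by simp
    ultimately show "expression M = (l, n, Q) \<longleftrightarrow>
      (\<forall>b\<in>I1. size (filter_mset (\<lambda>x. x \<in> U b) M) = l * period b) \<and>
      (\<forall>b\<in>I2. size (filter_mset (\<lambda>x. x \<in> U b) M) = n * period b) \<and>
      filter_mset (\<lambda>k. k > 0)
        (image_mset (\<lambda>b. size (filter_mset (\<lambda>x. x \<in> U b) M) div period b) (mset_set I0)) = Q"
      unfolding expression_def tile_def[symmetric] by simp
  qed
  have q1: "?p div quot b = ?p div e" if "b \<in> I1" for b using that by (simp add: quot_def)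
  have q2: "?p div quot b = ?p div f" if "b \<in> I2" for b using that not_I2[OF that] by (simp add: quot_def)
  have q0: "?p div quot b = ?p div central_quotient A" if "b \<in> I0" for b using that not_I0[OF that] by (simp add: quot_def)
  note count = card_invariant_multisets_labelled[where T=T and U=U and s=period and
      r="\<lambda>b. ?p div quot b" and l=l and n=n and A=I1 and C=I2 and B=I0,
      OF perm_T _ U_disjoint U_closed _ orbit_period period_pos card_U refl I_disjoint q1 q2 q0 Q0 Qo]
  show "finite {M \<in> Inv. expression M = (l, n, Q)}"
    unfolding X_eq by (rule count(1)) simp_all
  \<comment> \<open>These exponents, 0 or 1, produce the starred factors with their default value
    1.\<close>
  have cI: "card I1 = (if parabolic A \<or> hyperbolic A then 1 else 0)" "card I2 = (if hyperbolic A then 1 else 0)"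
    unfolding I1_def I2_def card_S1[symmetric] card_S2[symmetric] by (simp_all add: card_image)
  have "real (card ?X) =
      fact (card I0) / (fact (card I0 - size Q) * (\<Prod>q\<in>set_mset Q. fact (count Q q))) *
      real ((l + ?p div e - 1) choose l) ^ card I1 * real ((n + ?p div f - 1) choose n) ^ card I2 *
      (\<Prod>q\<in>set_mset Q. real ((q + ?p div central_quotient A - 1) choose q) ^ count Q q)"
    by (rule count(2)) simp_all
  also have "\<dots> = tiling_count A e f (l, n, Q)"
    unfolding cI card_I0 by (simp add: tiling_count_def orbit_choices_def)
  finally show "real (card {M \<in> Inv. expression M = (l, n, Q)}) = tiling_count A e f (l, n, Q)"
    unfolding X_eq .
qed

text \<open>Needed to add up the fibres. A positive \<open>l\<close>, \<open>n\<close> or member of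
  \<open>Q\<close> is bounded by a part of the partition, hence by the sum of the parts. Where no
  eigenline carries \<open>e\<close> or \<open>f\<close>, that number could be 0 and gives no bound;
  feasibility then forces \<open>l\<close> or \<open>n\<close> to vanish.\<close>

lemma finite_feasible_expressions: "finite (feasible_expressions A e f P)"
proof -
  let ?s = "\<Sum>\<^sub># P"
  have "feasible_expressions A e f P \<subseteq>
      {..?s} \<times> {..?s} \<times> (\<Union>k\<le>orbit_number A. multisets_of_size {..?s} k)"
  proof
    fix E assume E: "E \<in> feasible_expressions A e f P"
    obtain l n Q where lnQ: "E = (l, n, Q)" by (cases E) auto
    have feas: "feasible A (l, n, Q)" and P: "P = expressed_partition A e f (l, n, Q)"
      using E lnQ by (auto simp: feasible_expressions_def)
    have "l \<le> ?s"
    proof (cases "l = 0 \<or> S1 = {}")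
      case True
      then show ?thesis using feasible_without_eigenlines(1)[OF feas] by auto
    next
      case False
      then have "e > 0" "l > 0" using e_pos by auto
      then have "l * e \<in># P" unfolding P by (simp add: expressed_partition_def)
      then have "l * e \<le> ?s" by (rule mem_le_sum_mset)
      moreover have "l \<le> l * e" using \<open>e > 0\<close> by simp
      ultimately show ?thesis by (rule order_trans[rotated])
    qed
    moreover have "n \<le> ?s"
    proof (cases "n = 0 \<or> S2 = {}")
      case True
      then show ?thesis using feasible_without_eigenlines(2)[OF feas] by auto
    next
      case False
      then have "f > 0" "n > 0" using f_pos by auto
      then have "n * f \<in># P" unfolding P by (simp add: expressed_partition_def)
      then have "n * f \<le> ?s" by (rule mem_le_sum_mset)
      moreover have "n \<le> n * f" using \<open>f > 0\<close> by simp
      ultimately show ?thesis by (rule order_trans[rotated])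
    qed
    moreover have "q \<le> ?s" if "q \<in># Q" for q
    proof -
      have "q * central_quotient A \<in># P"
        unfolding P using that central_indicator_pos[OF inv]
        by (auto simp: expressed_partition_def mem_repeat_mset)
      then have "q * central_quotient A \<le> ?s" by (rule mem_le_sum_mset)
      moreover have "q \<le> q * central_quotient A" using central_quotient_pos[OF inv] by simp
      ultimately show ?thesis by (rule order_trans[rotated])
    qed
    moreover have "size Q \<le> orbit_number A" using feas by (simp add: feasible_def)
    ultimately show "E \<in> {..?s} \<times> {..?s} \<times> (\<Union>k\<le>orbit_number A. multisets_of_size {..?s} k)"
      unfolding lnQ by (auto simp: multisets_of_size_def)
  qed
  moreover have "finite ({..?s} \<times> {..?s} \<times> (\<Union>k\<le>orbit_number A. multisets_of_size {..?s} k))"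
    by (intro finite_cartesian_product finite_UN_I finite_multisets_of_size) auto
  ultimately show ?thesis by (rule finite_subset)
qed

text \<open>For invariant multisets of non-zero vectors the sum vanishes, as 1 is not an eigenvalue,
  and spanning means feasibility of the expression. Membership in \<open>Fix P A\<close> therefore
  depends on the expression alone.\<close>

lemma Fix_eq: "Fix P A = (\<Union>E\<in>feasible_expressions A e f P. {M \<in> Inv. expression M = E})"
proof (intro equalityI subsetI)
  fix M assume "M \<in> Fix P A"
  then have zs: "zero_sum_multiset M" and P: "partition_type M = P" and im: "image_mset T M = M"
    by (simp_all add: Fix_def multisets_of_type_def)
  have M0: "0 \<notin># M" using zs by (simp add: zero_sum_multiset_def)
  then have M: "M \<in> Inv" using im by (auto simp: Inv_def invariant_multisets_def)
  have "size (partition_type M) \<ge> 2"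
    using zs zero_sum_multiset_iff[OF M0] sum_mset_invariant_eq_0[OF no1 im] by simp
  then have "expression M \<in> feasible_expressions A e f P"
    using feasible_iff[OF M] partition_type_eq[OF M] P by (simp add: feasible_expressions_def)
  then show "M \<in> (\<Union>E\<in>feasible_expressions A e f P. {M \<in> Inv. expression M = E})" using M by blast
next
  fix M assume "M \<in> (\<Union>E\<in>feasible_expressions A e f P. {M \<in> Inv. expression M = E})"
  then have M: "M \<in> Inv" and E: "expression M \<in> feasible_expressions A e f P" by auto
  have "size (partition_type M) \<ge> 2" and P: "partition_type M = P"
    using E feasible_iff[OF M] partition_type_eq[OF M] by (auto simp: feasible_expressions_def)
  then have "zero_sum_multiset M"
    using zero_sum_multiset_iff[OF InvD(2)[OF M]] sum_mset_invariant_eq_0[OF no1 InvD(1)[OF M]] by simp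
  then show "M \<in> Fix P A" using P InvD(1)[OF M] by (simp add: Fix_def multisets_of_type_def)
qed

text \<open>The fibres are disjoint because \<open>expression\<close> is a function, and each
  contributes its own \<open>tiling_count\<close>.\<close>

lemma card_Fix: "real (card (Fix P A)) = (\<Sum>E\<in>feasible_expressions A e f P. tiling_count A e f E)"
proof -
  have feas: "feasible A E" if "E \<in> feasible_expressions A e f P" for E
    using that by (simp add: feasible_expressions_def)
  have "card (Fix P A) = (\<Sum>E\<in>feasible_expressions A e f P. card {M \<in> Inv. expression M = E})"
    unfolding Fix_eq
  proof (rule card_UN_disjoint[OF finite_feasible_expressions])
    show "\<forall>E\<in>feasible_expressions A e f P. finite {M \<in> Inv. expression M = E}"
    proof
      fix E assume E: "E \<in> feasible_expressions A e f P"
      show "finite {M \<in> Inv. expression M = E}"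
        using feas[OF E] card_expression_fibre(1) by (cases E) auto
    qed
  qed blast
  also have "real \<dots> = (\<Sum>E\<in>feasible_expressions A e f P. real (card {M \<in> Inv. expression M = E}))"
    by simp
  also have "\<dots> = (\<Sum>E\<in>feasible_expressions A e f P. tiling_count A e f E)"
  proof (rule sum.cong[OF refl])
    fix E assume E: "E \<in> feasible_expressions A e f P"
    show "real (card {M \<in> Inv. expression M = E}) = tiling_count A e f E"
      using feas[OF E] card_expression_fibre(2) by (cases E) auto
  qed
  finally show ?thesis .
qed

end

text \<open>One instance of the formula counts the multisets with one given expression. If the
  partition admits several feasible expressions, all of them contribute and the total is the sum; a
  unique expression leaves the single product.\<close>

theorem theorem4:
  fixes \<sigma> :: "('a::{field,finite}) ^ 2 ^ 2"
    and P :: "nat multiset"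
    and Q :: "nat multiset"
    and e f l n :: nat
  assumes "prime CARD('a)" and "odd CARD('a)"
    and "invertible \<sigma>"
    and "\<not> eigenvalue \<sigma> 1"
    and "eigenvalue_orders \<sigma> e f"
    and "(l, n, Q) \<in> feasible_expressions \<sigma> e f P"
  shows "(feasible_expressions \<sigma> e f P = {(l, n, Q)} \<longrightarrow>
            real (card (Fix P \<sigma>)) = tiling_count \<sigma> e f (l, n, Q)) \<and>
         real (card (Fix P \<sigma>)) = (\<Sum>E \<in> feasible_expressions \<sigma> e f P. tiling_count \<sigma> e f E)"
proof -
  obtain S1 S2 where S: "S1 \<union> S2 = (if central \<sigma> then {} else eigenlines \<sigma>)" "S1 \<inter> S2 = {}"
    "card S1 = (if parabolic \<sigma> \<or> hyperbolic \<sigma> then 1 else 0)" "card S2 = (if hyperbolic \<sigma> then 1 else 0)"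
    "\<And>L. L \<in> S1 \<Longrightarrow> \<exists>a. mult_order a = e \<and> (\<forall>v\<in>L. \<sigma> *v v = a *s v)"
    "\<And>L. L \<in> S2 \<Longrightarrow> \<exists>a. mult_order a = f \<and> (\<forall>v\<in>L. \<sigma> *v v = a *s v)"
    using eigenline_split[OF assms(3,5)] by blast
  interpret line_blocks \<sigma> e f S1 S2
    by unfold_locales (use assms(1,3,4) S in auto)
  have "real (card (Fix P \<sigma>)) = (\<Sum>E \<in> feasible_expressions \<sigma> e f P. tiling_count \<sigma> e f E)"
    by (rule card_Fix)
  then show ?thesis by simp
qed

end
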